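(* Let $\mathcal T$ and $\widetilde{\mathcal T}$ be compact self-adjoint nonnegative operators in Hilbert spaces $H$ and $\widetilde H$, respectively, and suppose that $$\mathcal N(t,\mathcal T)\sim\varphi(1/t),\qquad \mathcal N(t,\widetilde{\mathcal T})\sim\widetilde\varphi(1/t),\qquad t\to0+,$$ where $\varphi$ and $\widetilde\varphi$ are nondecreasing unbounded functions on $(0,\infty)$ of class $C^2$, slowly varying at infinity. Then there exist functions $\alpha_\pm:(0,\infty)\to(0,\infty)$ with $\alpha_\pm(\varepsilon)\to1$ as $\varepsilon\to0+$, and real-valued functions $S(t,\varepsilon)$, $\widetilde S(t,\varepsilon)$ of $t,\varepsilon>0$, such that for every $\varepsilon>0$ the following two estimates hold for all $t>0$: $$\mathcal N(t,\mathcal T\otimes\widetilde{\mathcal T})\le\alpha_+(\varepsilon)\left[S(t,\varepsilon)+\widetilde S(t,\varepsilon)+\int_{\alpha_-(\varepsilon)/\varepsilon}^{\varepsilon\tau_+}\varphi(\tau_+/\sigma)\,d\widetilde\varphi(\sigma)\right],\qquad \tau_+=\alpha_+(\varepsilon)/t,$$ $$\mathcal N(t,\mathcal T\otimes\widetilde{\mathcal T})\ge\alpha_-(\varepsilon)\left[S(t,\varepsilon)+\widetilde S(t,\varepsilon)+\int_{\alpha_+(\varepsilon)/\varepsilon}^{\varepsilon\tau_-}\varphi(\tau_-/\sigma)\,d\widetilde\varphi(\sigma)\right],\qquad \tau_-=\alpha_-(\varepsilon)/t,$$ where each integral is omitted (replaced by $0$) when its lower limit exceeds its upper limit; and, for each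 fixed $\varepsilon>0$, as $t\to0+$, $$S(t,\varepsilon)\sim\varphi(1/t)\,\widetilde\varphi(1/\varepsilon),\qquad \widetilde S(t,\varepsilon)=o(\widetilde\varphi(1/t)).$$
   Context: A positive function $\varphi(\tau)$, $\tau>0$, is slowly varying at infinity if $\varphi(c\tau)/\varphi(\tau)\to1$ as $\tau\to+\infty$ for every $c>0$. For a compact self-adjoint nonnegative operator $\mathcal T$, $\lambda_n(\mathcal T)$ denotes its positive eigenvalues repeated according to multiplicity, and $\mathcal N(t,\mathcal T)=\#\{n:\lambda_n(\mathcal T)>t\}$, $t>0$, is its counting function. $\mathcal T\otimes\widetilde{\mathcal T}$ acts in the Hilbert space tensor product $H\otimes\widetilde H$. The notation $f\sim g$ means $f/g\to1$. *)

theory Defs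
  imports "HOL-Analysis.Analysis" "HOL-Library.Landau_Symbols"
begin

text \<open>
  HOL-Analysis has real inner product spaces only. The class below describes the possible scalar
  fields: a real normed field with an additive map \<open>conjg\<close> such that
  \<open>c * conjg c = \<bar>c\<bar>\<^sup>2\<close> consists of roots of real quadratic polynomials
  (both \<open>c + conjg c\<close> and \<open>c * conjg c\<close> are real), so it is a copy of the field of
  real numbers or of the field of complex numbers, with the usual conjugation.
\<close>

class real_or_complex = real_normed_field +
  fixes conjg :: "'a \<Rightarrow> 'a"
  assumes conjg_add: "conjg (x + y) = conjg x + conjg y"
    and mult_conjg: "x * conjg x = (norm x)\<^sup>2 *\<^sub>R 1"

instantiation real :: real_or_complex
begin

definition conjg_real :: "real \<Rightarrow> real" where "conjg_real x = x"

instance by standard (auto simp: conjg_real_def power2_eq_square)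

end

instantiation complex :: real_or_complex
begin

definition conjg_complex :: "complex \<Rightarrow> complex" where "conjg_complex = cnj"

instance
proof
  show "conjg (x + y) = conjg x + conjg y" for x y :: complex
    by (simp add: conjg_complex_def)
  show "x * conjg x = (norm x)\<^sup>2 *\<^sub>R 1" for x :: complex
    unfolding conjg_complex_def scaleR_conv_of_real complex_norm_square by (rule mult_1_right[symmetric])
qed

end

text \<open>
  Norm, topology and completeness are those of the class \<^class>\<open>banach\<close>;
  the inner product \<open>ip\<close> is linear in its first argument.
\<close>

locale hilbert_space = vector_space smul
  for smul :: "'k :: real_or_complex \<Rightarrow> 'a :: banach \<Rightarrow> 'a" +
  fixes ip :: "'a \<Rightarrow> 'a \<Rightarrow> 'k"
  assumes smul_of_real: "smul (of_real r) x = r *\<^sub>R x"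
    and ip_add_left: "ip (x + y) z = ip x z + ip y z"
    and ip_smul_left: "ip (smul c x) z = c * ip x z"
    and ip_conjg: "ip y x = conjg (ip x y)"
    and ip_norm: "ip x x = of_real ((norm x)\<^sup>2)"

lemma hilbert_space_real_inner:
  "hilbert_space (*\<^sub>R) (inner :: 'a :: {real_inner, banach} \<Rightarrow> 'a \<Rightarrow> real)"
proof
  show "inner y x = conjg (inner x y)" for x y :: 'a
    by (simp only: conjg_real_def inner_commute)
qed (simp_all add: scaleR_add_right scaleR_add_left inner_add_left power2_norm_eq_inner)

definition compact_operator :: "('k :: real_or_complex \<Rightarrow> 'a :: banach \<Rightarrow> 'a) \<Rightarrow> ('a \<Rightarrow> 'a) \<Rightarrow> bool"
  where "compact_operator smul T \<longleftrightarrow>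
    Vector_Spaces.linear smul smul T \<and> compact (closure (T ` cball 0 1))"

definition self_adjoint :: "('a \<Rightarrow> 'a \<Rightarrow> 'k) \<Rightarrow> ('a \<Rightarrow> 'a) \<Rightarrow> bool"
  where "self_adjoint ip T \<longleftrightarrow> (\<forall>x y. ip (T x) y = ip x (T y))"

definition nonneg_operator :: "('a \<Rightarrow> 'a \<Rightarrow> 'k :: real_or_complex) \<Rightarrow> ('a \<Rightarrow> 'a) \<Rightarrow> bool"
  where "nonneg_operator ip T \<longleftrightarrow> (\<forall>x. \<exists>r\<ge>0. ip (T x) x = of_real r)"

definition eigenspace :: "('k :: real_or_complex \<Rightarrow> 'a :: banach \<Rightarrow> 'a) \<Rightarrow> ('a \<Rightarrow> 'a) \<Rightarrow> real \<Rightarrow> 'a set"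
  where "eigenspace smul T l = {x. T x = smul (of_real l) x}"

text \<open>
  The number of eigenvalues above \<open>t\<close>, repeated according to multiplicity: the multiplicities
  (dimensions of the eigenspaces over the scalar field) are added up over the distinct
  eigenvalues. For a compact self-adjoint operator and \<open>t > 0\<close> the set of summation and
  all multiplicities involved are finite, so the conventions for infinite sums and dimensions
  play no role.
\<close>

definition counting_function ::
    "('k :: real_or_complex \<Rightarrow> 'a :: banach \<Rightarrow> 'a) \<Rightarrow> ('a \<Rightarrow> 'a) \<Rightarrow> real \<Rightarrow> nat"
  where "counting_function smul T t =
    (\<Sum>l | t < l \<and> eigenspace smul T l \<noteq> {0}. vector_space.dim smul (eigenspace smul T l))"

text \<open>
  The Hilbert space tensor product, which is determined up to unitary isomorphism: a Hilbert space
  with a bilinear map \<open>tens\<close> into it that is multiplicative on inner products and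
  whose values (the elementary tensors) have a dense linear span.
\<close>

locale hilbert_tensor_product =
  left: hilbert_space smul1 ip1 +
  right: hilbert_space smul2 ip2 +
  prod: hilbert_space smul3 ip3
  for smul1 :: "'k :: real_or_complex \<Rightarrow> 'a :: banach \<Rightarrow> 'a" and ip1
    and smul2 :: "'k \<Rightarrow> 'b :: banach \<Rightarrow> 'b" and ip2
    and smul3 :: "'k \<Rightarrow> 'c :: banach \<Rightarrow> 'c" and ip3 +
  fixes tens :: "'a \<Rightarrow> 'b \<Rightarrow> 'c"
  assumes tens_linear_left: "Vector_Spaces.linear smul1 smul3 (\<lambda>x. tens x y)"
    and tens_linear_right: "Vector_Spaces.linear smul2 smul3 (\<lambda>y. tens x y)"
    and ip_tens: "ip3 (tens x y) (tens x' y') = ip1 x x' * ip2 y y'"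
    and dense_tens: "closure (prod.span {tens x y |x y. True}) = UNIV"

text \<open>
  \<open>U\<close> is the operator \<open>T \<otimes> T'\<close>, the bounded operator given by
  \<open>x \<otimes> y \<mapsto> T x \<otimes> T' y\<close> on elementary tensors.
\<close>

definition tensor_operator ::
    "('k :: real_or_complex \<Rightarrow> 'c :: banach \<Rightarrow> 'c) \<Rightarrow> ('a \<Rightarrow> 'b \<Rightarrow> 'c) \<Rightarrow>
      ('a \<Rightarrow> 'a) \<Rightarrow> ('b \<Rightarrow> 'b) \<Rightarrow> ('c \<Rightarrow> 'c) \<Rightarrow> bool"
  where "tensor_operator smul3 tens T T' U \<longleftrightarrow>
    Vector_Spaces.linear smul3 smul3 U \<and> bounded_linear U \<and>
    (\<forall>x y. U (tens x y) = tens (T x) (T' y))"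

lemma (in hilbert_tensor_product) tensor_operator_unique:
  assumes "tensor_operator smul3 tens T T' U" "tensor_operator smul3 tens T T' V"
  shows "U = V"
proof
  fix z
  have lin: "Vector_Spaces.linear smul3 smul3 U" "Vector_Spaces.linear smul3 smul3 V"
    and bl: "bounded_linear U" "bounded_linear V"
    and eq: "\<And>x y. U (tens x y) = V (tens x y)"
    using assms by (auto simp: tensor_operator_def)
  interpret pair: vector_space_pair smul3 smul3 ..
  have span_sub: "prod.span {tens x y |x y. True} \<subseteq> {z. U z = V z}"
  proof
    fix w assume "w \<in> prod.span {tens x y |x y. True}"
    then show "w \<in> {z. U z = V z}"
      using pair.linear_eq_on_span[OF lin, of "{tens x y |x y. True}" w] eq by fast
  qed
  have "closed {z. U z = V z}"
    by (rule closed_Collect_eq) (rule linear_continuous_on[OF bl(1)] linear_continuous_on[OF bl(2)])+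
  then have "closure (prod.span {tens x y |x y. True}) \<subseteq> {z. U z = V z}"
    by (rule closure_minimal[OF span_sub])
  then show "U z = V z"
    unfolding dense_tens by blast
qed

definition slowly_varying :: "(real \<Rightarrow> real) \<Rightarrow> bool"
  where "slowly_varying f \<longleftrightarrow>
    (\<forall>x>0. f x > 0) \<and> (\<forall>c>0. ((\<lambda>x. f (c * x) / f x) \<longlongrightarrow> 1) at_top)"

definition C2_on_pos :: "(real \<Rightarrow> real) \<Rightarrow> bool"
  where "C2_on_pos f \<longleftrightarrow> (\<exists>f' f''.
    (\<forall>x>0. (f has_real_derivative f' x) (at x)) \<and>
    (\<forall>x>0. (f' has_real_derivative f'' x) (at x)) \<and>
    continuous_on {0<..} f'')"

text \<open>
  The Lebesgue-Stieltjes integral of \<open>f\<close> with respect to a nondecreasing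
  continuous \<open>F\<close> over \<open>[a, b]\<close>, omitted if \<open>a > b\<close>. Since
  \<^const>\<open>interval_measure\<close> needs an integrator that is nondecreasing on the whole
  line, \<open>F\<close> is extended from \<open>[a, b]\<close> by its values at the end points, which
  carries no mass outside \<open>[a, b]\<close>.
\<close>

definition stieltjes_integral :: "(real \<Rightarrow> real) \<Rightarrow> real \<Rightarrow> real \<Rightarrow> (real \<Rightarrow> real) \<Rightarrow> real"
  where "stieltjes_integral F a b f =
    (if a \<le> b
     then set_lebesgue_integral (interval_measure (\<lambda>x. F (max a (min b x)))) {a..b} f
     else 0)"

end

theory Submission
  imports Defs
begin

text \<open>
  If \<open>l\<close> and \<open>m\<close> enumerate the positive eigenvalues of \<open>T\<close> and \<open>T'\<close>, those of the tensor product are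
  the products \<open>l i * m j\<close>, so its counting function at \<open>t\<close> is the number of pairs with
  \<open>l i * m j > t\<close>. The pairs with \<open>m j > \<epsilon>\<close> contribute asymptotically \<open>\<phi> (1 / t)\<close> for each \<open>j\<close>;
  those with \<open>m j \<le> t / \<epsilon>\<close> force \<open>l i > \<epsilon>\<close> and contribute finitely many increments of the second
  counting function between multiples of \<open>t\<close>, which are \<open>o(\<psi> (1 / t))\<close> by slow variation; for the
  remaining \<open>j\<close> both counting functions are in their asymptotic regime, and summation by parts
  turns the sum into the Stieltjes integral. The boundary term at \<open>1 / \<epsilon>\<close> replaces
  the count of \<open>m j > \<epsilon>\<close> by \<open>\<psi> (1 / \<epsilon>)\<close>, and the one at \<open>\<epsilon> / t\<close> has a favourable sign.

  Once these bounds hold up to errors \<open>\<delta> * (\<phi> (1 / t) + \<psi> (1 / t))\<close>, the functions \<open>S\<close> and \<open>S'\<close> are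
  obtained by moving \<open>\<phi> (1 / t) * \<psi> (1 / \<epsilon>)\<close> into the interval which the two estimates prescribe
  for \<open>S t + S' t\<close>; this takes care of all \<open>t > 0\<close> at once.
\<close>

section \<open>Compact self-adjoint operators\<close>

text \<open>Dividing the axiom \<open>mult_conjg\<close> by \<open>x\<close> determines
  \<open>conjg x\<close>. Multiplicativity, isometry and the values at real scalars, none of them
  class axioms, follow from this formula.\<close>

lemma conjg_eq: "conjg x = (norm x)\<^sup>2 *\<^sub>R inverse x" if "x \<noteq> 0" for x :: "'a::real_or_complex"
proof -
  have "inverse x * (x * conjg x) = inverse x * ((norm x)\<^sup>2 *\<^sub>R 1)"
    by (simp only: mult_conjg)
  then show ?thesis
    using that by (simp flip: mult.assoc)
qed

lemma conjg_zero [simp]: "conjg (0 :: 'a::real_or_complex) = 0"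
  using conjg_add[of "0::'a" 0] by simp

lemma norm_conjg [simp]: "norm (conjg x) = norm (x :: 'a::real_or_complex)"
  by (cases "x = 0") (simp_all add: conjg_eq norm_inverse power2_eq_square)

lemma conjg_mult: "conjg (x * y) = conjg x * conjg (y :: 'a::real_or_complex)"
  by (cases "x = 0 \<or> y = 0") (auto simp: conjg_eq norm_mult power_mult_distrib)

lemma conjg_of_real [simp]: "conjg (of_real r) = (of_real r :: 'a::real_or_complex)"
  by (cases "r = 0") (simp_all add: conjg_eq scaleR_conv_of_real power2_eq_square)

section \<open>Inner products and orthonormal families\<close>

context hilbert_space
begin

lemma ip_smul_right: "ip x (smul c y) = conjg c * ip x y"
  by (metis ip_conjg ip_smul_left conjg_mult)

lemma ip_add_right: "ip x (y + z) = ip x y + ip x z"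
  by (metis ip_conjg ip_add_left conjg_add)

lemma ip_zero_left [simp]: "ip 0 x = 0"
  using ip_add_left[of 0 0 x] by simp

lemma ip_zero_right [simp]: "ip x 0 = 0"
  using ip_add_right[of x 0 0] by simp

lemma ip_diff_left: "ip (x - y) z = ip x z - ip y z"
  using ip_add_left[of "x - y" y z] by simp

lemma ip_diff_right: "ip z (x - y) = ip z x - ip z y"
  using ip_add_right[of z "x - y" y] by simp

lemma ip_sum_left: "ip (\<Sum>i\<in>A. f i) x = (\<Sum>i\<in>A. ip (f i) x)"
  by (induction A rule: infinite_finite_induct) (auto simp: ip_add_left)

lemma ip_scaleR_left: "ip (r *\<^sub>R x) y = r *\<^sub>R ip x y"
  by (simp flip: smul_of_real add: ip_smul_left scaleR_conv_of_real)

lemma ip_scaleR_right: "ip x (r *\<^sub>R y) = r *\<^sub>R ip x y"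
  by (simp flip: smul_of_real add: ip_smul_right scaleR_conv_of_real)

lemma ip_orth_sym: "ip x y = 0 \<Longrightarrow> ip y x = 0"
  by (metis ip_conjg conjg_zero)

text \<open>Expanding \<open>ip u u\<close> for the vector \<open>u\<close> of the proof gives the
  square of \<open>norm y\<close> times the defect of the squared inequality. Scaling
  \<open>x\<close> by the square of \<open>norm y\<close> avoids a division.\<close>

lemma Cauchy_Schwarz_ip: "norm (ip x y) \<le> norm x * norm y"
proof (cases "y = 0")
  case False
  define c where "c = ip x y"
  define u where "u = (norm y)\<^sup>2 *\<^sub>R x - smul c y"
  have yx: "ip y x = conjg c"
    unfolding c_def by (rule ip_conjg)
  have cc: "c * conjg c = of_real ((norm c)\<^sup>2)"
    by (simp add: mult_conjg scaleR_conv_of_real)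
  have "of_real ((norm u)\<^sup>2) = ip u u"
    by (simp add: ip_norm)
  also have "\<dots> = of_real ((norm y)\<^sup>2 * ((norm y)\<^sup>2 * (norm x)\<^sup>2 - (norm c)\<^sup>2))"
    unfolding u_def ip_diff_left ip_diff_right ip_scaleR_left ip_scaleR_right ip_smul_left
      ip_smul_right yx c_def[symmetric] ip_norm[of x] ip_norm[of y]
    using cc by (simp add: scaleR_conv_of_real algebra_simps power2_eq_square)
  finally have "(norm u)\<^sup>2 = (norm y)\<^sup>2 * ((norm y)\<^sup>2 * (norm x)\<^sup>2 - (norm c)\<^sup>2)"
    by (simp only: of_real_eq_iff)
  then have "0 \<le> (norm y)\<^sup>2 * ((norm y)\<^sup>2 * (norm x)\<^sup>2 - (norm c)\<^sup>2)"
    by (metis zero_le_power2)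
  then have "0 \<le> (norm y)\<^sup>2 * (norm x)\<^sup>2 - (norm c)\<^sup>2"
    using False by (simp add: zero_le_mult_iff)
  then have "(norm c)\<^sup>2 \<le> (norm x * norm y)\<^sup>2"
    by (simp add: power_mult_distrib mult.commute)
  then show ?thesis
    unfolding c_def by (rule power2_le_imp_le) simp
qed simp

lemma bounded_linear_ip_left: "bounded_linear (\<lambda>x. ip x y)"
  by (rule bounded_linear_intro[where K = "norm y"])
    (simp_all add: ip_add_left ip_scaleR_left Cauchy_Schwarz_ip)

lemma closed_orthogonal: "closed {x. \<forall>e\<in>S. ip x e = 0}"
proof -
  have "{x. \<forall>e\<in>S. ip x e = 0} = (\<Inter>e\<in>S. {x. ip x e = 0})"
    by auto
  moreover have "closed {x. ip x e = 0}" for e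
    by (intro closed_Collect_eq continuous_intros linear_continuous_on bounded_linear_ip_left)
  ultimately show ?thesis
    by auto
qed

definition orthonormal_on :: "'i set \<Rightarrow> ('i \<Rightarrow> 'a) \<Rightarrow> bool"
  where "orthonormal_on I e \<longleftrightarrow> (\<forall>i\<in>I. \<forall>j\<in>I. ip (e i) (e j) = (if i = j then 1 else 0))"

lemma orthonormal_onD:
  "orthonormal_on I e \<Longrightarrow> i \<in> I \<Longrightarrow> j \<in> I \<Longrightarrow> ip (e i) (e j) = (if i = j then 1 else 0)"
  by (auto simp: orthonormal_on_def)

lemma orthonormal_on_subset: "orthonormal_on I e \<Longrightarrow> J \<subseteq> I \<Longrightarrow> orthonormal_on J e"
  by (simp add: orthonormal_on_def subset_iff)

lemma inj_on_orthonormal: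
  assumes "orthonormal_on I e"
  shows "inj_on e I"
proof (rule inj_onI)
  fix i j assume ij: "i \<in> I" "j \<in> I" "e i = e j"
  then have "ip (e i) (e j) = 1"
    using orthonormal_onD[OF assms ij(1) ij(1)] by simp
  then show "i = j"
    using orthonormal_onD[OF assms ij(1,2)] by (auto split: if_splits)
qed

lemma ip_sum_orthonormal:
  assumes "orthonormal_on I e" "finite I" "j \<in> I"
  shows "ip (\<Sum>i\<in>I. smul (c i) (e i)) (e j) = c j"
proof -
  have "ip (\<Sum>i\<in>I. smul (c i) (e i)) (e j) = (\<Sum>i\<in>I. if i = j then c i else 0)"
    using assms(1,3) by (auto simp: ip_sum_left ip_smul_left orthonormal_onD intro!: sum.cong)
  then show ?thesis
    using assms by simp
qed

lemma independent_orthonormal: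
  assumes "orthonormal_on I e" "finite I"
  shows "independent (e ` I)"
proof (rule independent_if_scalars_zero)
  fix f x assume f: "(\<Sum>x\<in>e ` I. smul (f x) x) = 0" "x \<in> e ` I"
  then obtain j where j: "x = e j" "j \<in> I" by auto
  have "(\<Sum>i\<in>I. smul (f (e i)) (e i)) = 0"
    using f(1) inj_on_orthonormal[OF assms(1)] by (simp add: sum.reindex)
  then show "f x = 0"
    using ip_sum_orthonormal[OF assms j(2), of "\<lambda>i. f (e i)"] j by simp
qed (use assms in auto)

lemma orth_proj_diff:
  assumes "orthonormal_on I e" "finite I" "j \<in> I"
  shows "ip (x - (\<Sum>i\<in>I. smul (ip x (e i)) (e i))) (e j) = 0"
  using ip_sum_orthonormal[OF assms] by (simp add: ip_diff_left)

text \<open>The remainder \<open>y\<close> is orthogonal to the projection \<open>p\<close>, so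
  \<open>ip x y = ip y y\<close>; Cauchy-Schwarz then bounds the square of \<open>norm y\<close> by
  \<open>norm x * norm y\<close>.\<close>

lemma norm_orth_proj_diff_le:
  assumes "orthonormal_on I e" "finite I"
  shows "norm (x - (\<Sum>i\<in>I. smul (ip x (e i)) (e i))) \<le> norm x"
proof -
  define p where "p = (\<Sum>i\<in>I. smul (ip x (e i)) (e i))"
  define y where "y = x - p"
  have "ip y (e i) = 0" if "i \<in> I" for i
    unfolding y_def p_def by (rule orth_proj_diff[OF assms that])
  then have "ip p y = 0"
    unfolding p_def by (auto simp: ip_sum_left ip_smul_left ip_orth_sym intro!: sum.neutral)
  then have "ip x y = ip y y"
    unfolding y_def by (simp add: ip_diff_left)
  then have "norm (ip x y) = (norm y)\<^sup>2"
    by (simp add: ip_norm norm_power)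
  then have "norm y * norm y \<le> norm x * norm y"
    using Cauchy_Schwarz_ip[of x y] by (simp only: power2_eq_square)
  then have "norm y \<le> norm x"
    by (cases "y = 0") auto
  then show ?thesis
    by (simp only: p_def y_def)
qed

text \<open>\<open>bounded_linear\<close> is linearity over the reals, so homogeneity over
  \<open>'k\<close> is a separate clause. Such functionals serve as tests of completeness in place
  of series expansions.\<close>

definition functional :: "('a \<Rightarrow> 'k) \<Rightarrow> bool"
  where "functional g \<longleftrightarrow> bounded_linear g \<and> (\<forall>c x. g (smul c x) = c * g x)"

lemma functional_ip: "functional (\<lambda>x. ip x y)"
  by (simp add: functional_def bounded_linear_ip_left ip_smul_left)

end

text \<open>The vectors \<open>e i\<close> need not span the whole space: \<open>total\<close> says
  that the range of \<open>T\<close> lies in their closed span, phrased through functionals. This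
  form needs no infinite series, and it passes to tensor products by freezing one factor at a time.
  \<open>ip_T_e\<close> is self-adjointness tested against the \<open>e i\<close>.\<close>

locale eigen_system = hilbert_space smul ip
  for smul :: "'k :: real_or_complex \<Rightarrow> 'a :: banach \<Rightarrow> 'a" and ip +
  fixes T :: "'a \<Rightarrow> 'a" and I :: "'i set" and e :: "'i \<Rightarrow> 'a" and l :: "'i \<Rightarrow> real"
  assumes T_linear: "Vector_Spaces.linear smul smul T"
    and orthonormal: "orthonormal_on I e"
    and l_pos: "i \<in> I \<Longrightarrow> l i > 0"
    and T_e: "i \<in> I \<Longrightarrow> T (e i) = smul (of_real (l i)) (e i)"
    and ip_T_e: "i \<in> I \<Longrightarrow> ip (T x) (e i) = of_real (l i) * ip x (e i)"
    and finite_level: "t > 0 \<Longrightarrow> finite {i \<in> I. t < l i}"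
    and total: "functional g \<Longrightarrow> (\<And>i. i \<in> I \<Longrightarrow> g (e i) = 0) \<Longrightarrow> g (T x) = 0"
begin

lemma T_add: "T (x + y) = T x + T y"
  and T_smul: "T (smul c x) = smul c (T x)"
  using T_linear by (auto simp: Vector_Spaces.linear_iff)

lemma T_diff: "T (x - y) = T x - T y"
  by (metis T_add add_diff_cancel_right' diff_add_cancel)

lemma T_zero [simp]: "T 0 = 0"
  using T_diff[of 0 0] by simp

lemma T_sum: "T (\<Sum>i\<in>A. f i) = (\<Sum>i\<in>A. T (f i))"
  by (induction A rule: infinite_finite_induct) (auto simp: T_add)

text \<open>\<open>ip_T_e\<close> makes \<open>T x\<close> orthogonal to every \<open>e i\<close>;
  hence the functional \<open>\<lambda>z. ip z (T x)\<close> vanishes on the system, and by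
  \<open>total\<close> also at \<open>T x\<close>.\<close>

lemma T_orth: "(\<And>i. i \<in> I \<Longrightarrow> ip x (e i) = 0) \<Longrightarrow> T x = 0"
proof -
  assume "\<And>i. i \<in> I \<Longrightarrow> ip x (e i) = 0"
  then have "ip (e i) (T x) = 0" if "i \<in> I" for i
    using ip_T_e[OF that, of x] that by (simp add: ip_orth_sym)
  then have "ip (T x) (T x) = 0"
    using total[OF functional_ip] by blast
  then show "T x = 0"
    by (simp add: ip_norm)
qed

lemma finite_eigenvalue:
  assumes "r > 0"
  shows "finite {i\<in>I. l i = r}"
  by (rule finite_subset[OF _ finite_level[of "r / 2"]]) (use assms in auto)

lemma eigenspace_eq:
  assumes "r > 0"
  shows "eigenspace smul T r = span (e ` {i\<in>I. l i = r})"
proof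
  let ?J = "{i\<in>I. l i = r}"
  show "eigenspace smul T r \<subseteq> span (e ` ?J)"
  proof
    fix x assume "x \<in> eigenspace smul T r"
    then have x: "T x = smul (of_real r) x"
      by (simp add: eigenspace_def)
    have on: "orthonormal_on ?J e"
      by (rule orthonormal_on_subset[OF orthonormal]) auto
    define p where "p = (\<Sum>i\<in>?J. smul (ip x (e i)) (e i))"
    \<comment> \<open>For \<open>l j = r\<close> this is the projection property; otherwise both
      terms vanish, since eigenvectors to different eigenvalues are orthogonal. So \<open>T\<close>
      kills \<open>x - p\<close> but also multiplies it by \<open>r\<close>, which leaves only
      \<open>x = p\<close>.\<close>
    have "ip (x - p) (e j) = 0" if j: "j \<in> I" for j
    proof (cases "l j = r")
      case True
      then show ?thesis
        unfolding p_def using j by (intro orth_proj_diff[OF on finite_eigenvalue[OF assms]]) auto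
    next
      case False
      have "of_real r * ip x (e j) = of_real (l j) * ip x (e j)"
        using ip_T_e[OF j, of x] by (simp add: x ip_smul_left)
      then have "ip x (e j) = 0"
        using False by auto
      moreover have "ip p (e j) = 0"
        unfolding p_def ip_sum_left
        using orthonormal_onD[OF orthonormal _ j] False by (intro sum.neutral) (auto simp: ip_smul_left)
      ultimately show ?thesis
        by (simp add: ip_diff_left)
    qed
    then have "T (x - p) = 0"
      by (rule T_orth)
    moreover have "T p = smul (of_real r) p"
      unfolding p_def T_sum scale_sum_right
      by (intro sum.cong) (auto simp: T_smul T_e mult.commute)
    ultimately have "smul (of_real r) (x - p) = 0"
      by (simp add: T_diff x scale_right_diff_distrib)
    then have "x = p"
      using assms by simp
    moreover have "p \<in> span (e ` ?J)"
      unfolding p_def by (intro span_sum span_scale span_base) auto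
    ultimately show "x \<in> span (e ` ?J)"
      by simp
  qed
  show "span (e ` ?J) \<subseteq> eigenspace smul T r"
  proof (rule span_minimal)
    show "e ` ?J \<subseteq> eigenspace smul T r"
      by (auto simp: eigenspace_def T_e)
    show "subspace (eigenspace smul T r)"
      unfolding subspace_def eigenspace_def
      by (auto simp: T_add T_smul scale_right_distrib mult.commute)
  qed
qed

text \<open>The dimension of each eigenspace is the number of indices with that eigenvalue, so the
  sum over the eigenvalues counts indices fibre by fibre of \<open>l\<close>.\<close>

lemma counting_function_eq:
  assumes "t > 0"
  shows "counting_function smul T t = card {i\<in>I. t < l i}"
proof -
  let ?J = "\<lambda>r. {i\<in>I. l i = r}"
  have on: "orthonormal_on (?J r) e" for r
    by (rule orthonormal_on_subset[OF orthonormal]) auto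
  have ind: "independent (e ` ?J r)" if "r > 0" for r
    by (rule independent_orthonormal[OF on finite_eigenvalue[OF that]])
  have dim: "dim (eigenspace smul T r) = card (?J r)" if "r > 0" for r
    using dim_span_eq_card_independent[OF ind[OF that]] card_image[OF inj_on_orthonormal[OF on]]
    unfolding eigenspace_eq[OF that] by metis
  \<comment> \<open>The eigenspace of \<open>r\<close> is the span of an independent set, so it is
    nonzero exactly when some index has \<open>l i = r\<close>. This identifies the set of summation
    with a finite image under \<open>l\<close>.\<close>
  have ne: "eigenspace smul T r \<noteq> {0} \<longleftrightarrow> r \<in> l ` {i\<in>I. t < l i}" if "t < r" for r
  proof -
    have r: "r > 0" using that assms by simp
    have "0 \<notin> e ` ?J r"
      using ind[OF r] dependent_zero[of "e ` ?J r"] by metis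
    then have "eigenspace smul T r = {0} \<longleftrightarrow> ?J r = {}"
    proof (cases "?J r = {}")
      case False
      then obtain i where "i \<in> ?J r" by blast
      then have "e i \<in> span (e ` ?J r)" "e i \<noteq> 0"
        using \<open>0 \<notin> e ` ?J r\<close> by (auto intro!: span_base simp: image_iff)
      then show ?thesis
        unfolding eigenspace_eq[OF r] using False by blast
    next
      case True
      then show ?thesis
        unfolding eigenspace_eq[OF r] by (simp only: image_empty span_empty refl)
    qed
    then show ?thesis
      using that by auto
  qed
  then have "{r. t < r \<and> eigenspace smul T r \<noteq> {0}} = l ` {i\<in>I. t < l i}"
    by auto
  then have "counting_function smul T t = (\<Sum>r\<in>l ` {i\<in>I. t < l i}. card (?J r))"
    unfolding counting_function_def using dim assms by (auto intro!: sum.cong)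
  \<comment> \<open>Adding \<open>t < l i\<close> does not change the fibres and gives the form in
    which \<open>sum.image_gen\<close> regroups the count.\<close>
  also have "\<dots> = (\<Sum>r\<in>l ` {i\<in>I. t < l i}. card {i \<in> {i\<in>I. t < l i}. l i = r})"
    by (intro sum.cong arg_cong[where f = card]) auto
  also have "\<dots> = card {i\<in>I. t < l i}"
    using sum.image_gen[OF finite_level[OF assms], of "\<lambda>_. 1::nat" l] by simp
  finally show ?thesis .
qed

end

section \<open>Spectral theorem for compact self-adjoint nonnegative operators\<close>

context hilbert_space
begin

lemma
  assumes "compact_operator smul T"
  shows compact_operator_add: "T (x + y) = T x + T y"
    and compact_operator_smul: "T (smul c x) = smul c (T x)"
    and compact_operator_scaleR: "T (r *\<^sub>R x) = r *\<^sub>R T x"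
proof -
  show "T (x + y) = T x + T y" and *: "T (smul c x) = smul c (T x)" for c x y
    using assms by (auto simp: compact_operator_def Vector_Spaces.linear_iff)
  show "T (r *\<^sub>R x) = r *\<^sub>R T x"
    using *[of "of_real r" x] by (simp add: smul_of_real)
qed

lemma bounded_linear_compact_operator:
  assumes T: "compact_operator smul T"
  shows "bounded_linear T"
proof -
  have "bounded (T ` cball 0 1)"
    using T compact_imp_bounded bounded_subset closure_subset unfolding compact_operator_def by blast
  then obtain K where K: "\<And>x. norm x \<le> 1 \<Longrightarrow> norm (T x) \<le> K"
    unfolding bounded_iff by (metis image_eqI mem_cball_0)
  show ?thesis
  proof (rule bounded_linear_intro)
    fix x
    show "norm (T x) \<le> norm x * K"
    proof (cases "x = 0")
      case True
      then show ?thesis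
        using compact_operator_scaleR[OF T, of 0 x] by simp
    next
      case False
      then have "norm (T ((1 / norm x) *\<^sub>R x)) \<le> K"
        by (intro K) simp
      then show ?thesis
        using False by (simp add: compact_operator_scaleR[OF T] field_simps)
    qed
  qed (simp_all add: compact_operator_add[OF T] compact_operator_scaleR[OF T])
qed

text \<open>A real inner product makes the two cross terms equal. Used for the equality case of
  Cauchy-Schwarz and, with \<open>r = 0\<close>, as the theorem of Pythagoras.\<close>

lemma norm_diff_square:
  assumes "ip u v = of_real r"
  shows "(norm (u - c *\<^sub>R v))\<^sup>2 = (norm u)\<^sup>2 - 2 * c * r + c\<^sup>2 * (norm v)\<^sup>2"
proof -
  have vu: "ip v u = of_real r"
    using ip_conjg[of v u] assms by simp
  have "ip (u - c *\<^sub>R v) (u - c *\<^sub>R v) = ip u u - 2 * of_real c * of_real r + of_real (c\<^sup>2) * ip v v"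
    by (simp add: ip_diff_left ip_diff_right ip_scaleR_left ip_scaleR_right assms vu
        scaleR_conv_of_real algebra_simps power2_eq_square)
  also have "\<dots> = of_real ((norm u)\<^sup>2 - 2 * c * r + c\<^sup>2 * (norm v)\<^sup>2)"
    unfolding ip_norm[of u] ip_norm[of v] by simp
  finally show ?thesis
    unfolding ip_norm[of "u - c *\<^sub>R v"] by (simp only: of_real_eq_iff)
qed

text \<open>
  The maximum \<open>m\<^sup>2\<close> of \<open>norm (T y)\<close> over the compact set \<open>closure (T (W \<inter> ball))\<close> is the norm of
  \<open>T\<^sup>2\<close> on \<open>W\<close>, and equality in the Cauchy-Schwarz inequality at a maximiser makes it an
  eigenvector of \<open>T\<^sup>2\<close>; then it is one of \<open>T\<close>, since \<open>- m\<close> is not an eigenvalue.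
\<close>

lemma max_eigenvalue:
  assumes T: "compact_operator smul T" "self_adjoint ip T" "nonneg_operator ip T"
    and S: "\<And>e. e \<in> S \<Longrightarrow> \<exists>c. T e = smul c e"
    and w: "\<And>e. e \<in> S \<Longrightarrow> ip w e = 0" "T w \<noteq> 0"
  shows "\<exists>m z. m > 0 \<and> norm z = 1 \<and> (\<forall>e\<in>S. ip z e = 0) \<and> T z = m *\<^sub>R z \<and>
    (\<forall>x. (\<forall>e\<in>S. ip x e = 0) \<longrightarrow> norm (T x) \<le> m * norm x)"
proof -
  define W where "W = {x. \<forall>e\<in>S. ip x e = 0}"
  note scaleR = compact_operator_scaleR[OF T(1)]
  have sa: "ip (T x) y = ip x (T y)" for x y
    using T(2) by (simp add: self_adjoint_def)
  have bl: "bounded_linear T"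
    by (rule bounded_linear_compact_operator[OF T(1)])
  have T_diff: "T (x - y) = T x - T y" for x y
    using bl by (simp add: linear_diff bounded_linear.linear)
  have W_scaleR: "c *\<^sub>R x \<in> W" if "x \<in> W" for c x
    using that by (simp add: W_def ip_scaleR_left)
  \<comment> \<open>\<open>W\<close> is invariant: moving \<open>T\<close> to the other side of the
    inner product meets an eigenvector from \<open>S\<close>.\<close>
  have W_T: "T x \<in> W" if "x \<in> W" for x
    unfolding W_def
  proof safe
    fix e assume "e \<in> S"
    then show "ip (T x) e = 0"
      using S[of e] that by (auto simp: sa ip_smul_right W_def)
  qed
  have "closed W"
    unfolding W_def by (rule closed_orthogonal)
  define K where "K = closure (T ` (W \<inter> cball 0 1))"
  have "compact K"
  proof -
    have "K = closure (T ` cball 0 1) \<inter> K"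
      unfolding K_def by (simp add: Int_absorb1 closure_mono image_mono)
    then show ?thesis
      using T(1) unfolding compact_operator_def K_def by (metis closed_closure compact_Int_closed)
  qed
  moreover have in_K: "T x \<in> K" if "x \<in> W" "norm x \<le> 1" for x
    unfolding K_def by (rule subsetD[OF closure_subset]) (use that in auto)
  moreover have "0 \<in> W"
    by (simp add: W_def)
  ultimately obtain y0 where y0: "y0 \<in> K" "\<And>y. y \<in> K \<Longrightarrow> norm (T y) \<le> norm (T y0)"
    using continuous_attains_sup[of K "\<lambda>y. norm (T y)"]
      linear_continuous_on[OF bl] continuous_on_norm by (metis empty_iff norm_zero zero_le_one)
  define m where "m = sqrt (norm (T y0))"
  have m2: "m\<^sup>2 = norm (T y0)"
    by (simp add: m_def)
  \<comment> \<open>Self-adjointness turns the square of \<open>norm (T x)\<close> into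
    \<open>ip (T (T x)) x\<close>, and \<open>T x\<close> lies in \<open>K\<close>, where the
    maximum is \<open>m\<^sup>2\<close>.\<close>
  have le1: "norm (T x) \<le> m" if x: "x \<in> W" "norm x \<le> 1" for x
  proof -
    have "(norm (T x))\<^sup>2 = norm (ip (T x) (T x))"
      by (simp add: ip_norm norm_power)
    also have "\<dots> = norm (ip (T (T x)) x)"
      by (simp add: sa)
    also have "\<dots> \<le> norm (T (T x)) * norm x"
      by (rule Cauchy_Schwarz_ip)
    also have "\<dots> \<le> norm (T y0) * 1"
      by (intro mult_mono y0(2) in_K x) auto
    finally show ?thesis
      by (simp add: m_def real_le_rsqrt)
  qed
  have le: "norm (T x) \<le> m * norm x" if "x \<in> W" for x
  proof (cases "x = 0")
    case True
    then show ?thesis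
      using scaleR[of 0 0] by simp
  next
    case False
    then have "norm (T ((1 / norm x) *\<^sub>R x)) \<le> m"
      by (intro le1 W_scaleR that) simp
    then show ?thesis
      using False by (simp add: scaleR field_simps)
  qed
  have "w \<in> W"
    using w(1) by (simp add: W_def)
  have "m > 0"
  proof -
    have "0 < m * norm w"
      using le[OF \<open>w \<in> W\<close>] w(2) by (meson less_le_trans zero_less_norm_iff)
    then show ?thesis
      by (simp add: zero_less_mult_iff)
  qed
  have "K \<subseteq> W \<inter> cball 0 m"
    unfolding K_def by (rule closure_minimal) (use W_T le1 \<open>closed W\<close> in auto)
  then have y0': "y0 \<in> W" "norm y0 \<le> m"
    using y0(1) by auto
  \<comment> \<open>\<open>y0\<close> is a limit of images of the unit ball of \<open>W\<close>, so
    \<open>norm y0 \<le> m\<close>. Rescaling gives a point of that ball where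
    \<open>norm (T z) = m\<close> is attained, although \<open>y0\<close> itself need not be an
    image.\<close>
  define z where "z = (1 / m) *\<^sub>R y0"
  have z: "z \<in> W" "norm z \<le> 1"
    using y0' \<open>m > 0\<close> by (auto simp: z_def W_scaleR)
  have Tz: "norm (T z) = m"
    using m2 \<open>m > 0\<close> by (simp add: z_def scaleR power2_eq_square field_simps)
  have "T (T z) = m\<^sup>2 *\<^sub>R z"
  proof -
    have "norm (T (T z)) \<le> m\<^sup>2"
      using le[OF W_T[OF z(1)]] by (simp add: Tz power2_eq_square)
    then have 1: "(norm (T (T z)))\<^sup>2 \<le> (m\<^sup>2)\<^sup>2"
      by (intro power_mono) auto
    have 2: "(m\<^sup>2)\<^sup>2 * (norm z)\<^sup>2 \<le> (m\<^sup>2)\<^sup>2"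
      using z(2) by (simp add: mult_left_le power_le_one)
    \<comment> \<open>With \<open>norm (T (T z)) \<le> m\<^sup>2\<close> and
      \<open>norm z \<le> 1\<close>, the expanded square is at most
      \<open>m^4 - 2 * m^4 + m^4 = 0\<close>.\<close>
    have "ip (T (T z)) z = of_real (m\<^sup>2)"
      using ip_norm[of "T z"] by (simp add: sa Tz)
    then have "(norm (T (T z) - m\<^sup>2 *\<^sub>R z))\<^sup>2 =
        (norm (T (T z)))\<^sup>2 - 2 * m\<^sup>2 * m\<^sup>2 + (m\<^sup>2)\<^sup>2 * (norm z)\<^sup>2"
      by (rule norm_diff_square)
    also have "\<dots> \<le> 0"
      using 1 2 by (simp add: power2_eq_square)
    finally show ?thesis
      by simp
  qed
  then have "T (T z - m *\<^sub>R z) = (- m) *\<^sub>R (T z - m *\<^sub>R z)"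
    by (simp add: T_diff scaleR scaleR_diff_right power2_eq_square)
  moreover obtain r where "r \<ge> 0" "ip (T (T z - m *\<^sub>R z)) (T z - m *\<^sub>R z) = of_real r"
    using T(3) unfolding nonneg_operator_def by blast
  ultimately have "ip ((- m) *\<^sub>R (T z - m *\<^sub>R z)) (T z - m *\<^sub>R z) = of_real r"
    by simp
  then have "of_real (- m * (norm (T z - m *\<^sub>R z))\<^sup>2) = (of_real r :: 'k)"
    by (simp only: ip_scaleR_left ip_norm scaleR_conv_of_real of_real_mult)
  then have "- m * (norm (T z - m *\<^sub>R z))\<^sup>2 = r"
    by (simp only: of_real_eq_iff)
  then have "m * (norm (T z - m *\<^sub>R z))\<^sup>2 \<le> 0"
    using \<open>r \<ge> 0\<close> by simp
  then have Tz': "T z = m *\<^sub>R z"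
    using \<open>m > 0\<close> by (simp add: mult_le_0_iff)
  then have "norm z = 1"
    using Tz \<open>m > 0\<close> by simp
  then show ?thesis
    using \<open>m > 0\<close> z(1) Tz' le unfolding W_def by blast
qed

text \<open>Distinct orthonormal eigenvectors with eigenvalues above \<open>t\<close> have images
  more than \<open>t\<close> apart, while compactness covers the image of the unit ball by finitely
  many balls of radius \<open>t / 2\<close>, each containing at most one of these images.\<close>

lemma finite_large_eigenvalues:
  assumes T: "compact_operator smul T"
    and on: "orthonormal_on E (\<lambda>v. v)"
    and eig: "\<And>v. v \<in> E \<Longrightarrow> T v = norm (T v) *\<^sub>R v"
    and t: "t > 0"
  shows "finite {v \<in> E. t < norm (T v)}"
proof -
  let ?J = "{v \<in> E. t < norm (T v)}"
  have norm1: "norm v = 1" if "v \<in> E" for v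
  proof -
    have "of_real ((norm v)\<^sup>2) = (of_real 1 :: 'k)"
      using orthonormal_onD[OF on that that] by (simp add: ip_norm)
    then have "(norm v)\<^sup>2 = 1"
      by (simp only: of_real_eq_iff)
    then show ?thesis
      by (simp add: power2_eq_1_iff) (smt (verit) norm_ge_zero)
  qed
  have far: "t < dist (T u) (T v)" if "u \<in> ?J" "v \<in> ?J" "u \<noteq> v" for u v
  proof -
    have uv: "u \<in> E" "v \<in> E" "t < norm (T u)"
      using that by auto
    have "ip u v = 0"
      using orthonormal_onD[OF on uv(1,2)] that by simp
    then have "ip (T u) (norm (T v) *\<^sub>R v) = of_real 0"
      using eig[OF uv(1)] by (metis ip_scaleR_left ip_scaleR_right of_real_0 scaleR_zero_right)
    then have "ip (T u) v = of_real 0"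
      using that t by (auto simp: ip_scaleR_right)
    then have "(norm (T u - norm (T v) *\<^sub>R v))\<^sup>2 = (norm (T u))\<^sup>2 + (norm (T v))\<^sup>2"
      using norm_diff_square[of "T u" v 0 "norm (T v)"] norm1[OF uv(2)] by simp
    then have "(norm (T u))\<^sup>2 \<le> (dist (T u) (T v))\<^sup>2"
      using eig[OF uv(2)] by (simp add: dist_norm)
    then have "norm (T u) \<le> dist (T u) (T v)"
      by (rule power2_le_imp_le) simp
    then show ?thesis
      using uv(3) by simp
  qed
  obtain k where k: "finite k" "closure (T ` cball 0 1) \<subseteq> (\<Union>x\<in>k. ball x (t / 2))"
    using T t unfolding compact_operator_def compact_eq_totally_bounded
    by (metis half_gt_zero)
  have "\<forall>v\<in>?J. \<exists>x. x \<in> k \<and> dist x (T v) < t / 2"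
  proof
    fix v assume "v \<in> ?J"
    then have "T v \<in> closure (T ` cball 0 1)"
      using norm1 by (intro subsetD[OF closure_subset]) auto
    then show "\<exists>x. x \<in> k \<and> dist x (T v) < t / 2"
      using k(2) by fastforce
  qed
  then obtain c where c: "\<And>v. v \<in> ?J \<Longrightarrow> c v \<in> k \<and> dist (c v) (T v) < t / 2"
    by metis
  have "inj_on c ?J"
  proof (rule inj_onI, rule ccontr)
    fix u v assume uv: "u \<in> ?J" "v \<in> ?J" "c u = c v" "u \<noteq> v"
    have "dist (c u) (T u) < t / 2" "dist (c u) (T v) < t / 2"
      using c[OF uv(1)] c[OF uv(2)] uv(3) by auto
    then have "dist (T u) (T v) < t"
      by (rule dist_triangle_half_r)
    then show False
      using far[OF uv(1,2,4)] by simp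
  qed
  then show ?thesis
    using c k(1) by (meson finite_imageD finite_subset image_subsetI)
qed

text \<open>Zorn's lemma gives a maximal orthonormal set \<open>E\<close> of eigenvectors with
  positive eigenvalues. It is indexed by itself, and the eigenvalue of a unit vector
  \<open>v\<close> in it is \<open>norm (T v)\<close>.\<close>

lemma ex_eigen_system:
  assumes T: "compact_operator smul T" "self_adjoint ip T" "nonneg_operator ip T"
  shows "\<exists>E. eigen_system smul ip T E (\<lambda>v. v) (\<lambda>v. norm (T v))"
proof -
  define A where "A = {E. (\<forall>v\<in>E. norm v = 1 \<and> (\<exists>m>0. T v = m *\<^sub>R v)) \<and>
    (\<forall>u\<in>E. \<forall>v\<in>E. u \<noteq> v \<longrightarrow> ip u v = 0)}"
  have "\<Union>C \<in> A" if C: "subset.chain A C" for C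
  proof -
    have "ip u v = 0" if uv: "u \<in> X" "X \<in> C" "v \<in> Y" "Y \<in> C" "u \<noteq> v" for u v X Y
    proof -
      have "X \<subseteq> Y \<or> Y \<subseteq> X"
        using C uv by (auto simp: subset.chain_def)
      then have "\<exists>Z\<in>C. u \<in> Z \<and> v \<in> Z"
        using uv by blast
      moreover have "C \<subseteq> A"
        using C by (auto simp: subset.chain_def)
      ultimately show ?thesis
        using uv(5) by (auto simp: A_def)
    qed
    moreover have "C \<subseteq> A"
      using C by (auto simp: subset.chain_def)
    ultimately show ?thesis
      unfolding A_def by blast
  qed
  then obtain E where E: "E \<in> A" and max: "\<And>X. X \<in> A \<Longrightarrow> E \<subseteq> X \<Longrightarrow> X = E"
    using subset_Zorn'[of A] by blast
  have norm1: "norm v = 1" and pos: "norm (T v) > 0" and eig: "T v = norm (T v) *\<^sub>R v"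
    if "v \<in> E" for v
    using E that by (auto simp: A_def)
  have on: "orthonormal_on E (\<lambda>v. v)"
    unfolding orthonormal_on_def using E norm1 by (auto simp: A_def ip_norm)
  have fin: "finite {v\<in>E. t < norm (T v)}" if "t > 0" for t
    by (rule finite_large_eigenvalues[OF T(1) on eig that])
  have ip_T: "ip (T x) v = norm (T v) *\<^sub>R ip x v" if "v \<in> E" for x v
    using T(2) eig[OF that] unfolding self_adjoint_def by (metis ip_scaleR_right)
  have eig': "T v = smul (of_real (norm (T v))) v" if "v \<in> E" for v
    using eig[OF that] by (simp add: smul_of_real)
  \<comment> \<open>The quantitative form of maximality: on the orthogonal complement of the
    finitely many eigenvectors above \<open>t\<close>, the norm of \<open>T\<close> is at most
    \<open>t\<close>.\<close>
  have small: "norm (T x) \<le> t * norm x"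
    if t: "t > 0" and x: "\<And>v. v \<in> E \<Longrightarrow> t < norm (T v) \<Longrightarrow> ip x v = 0" for t x
  proof (cases "T x = 0")
    case True
    then show ?thesis
      using t by simp
  next
    case False
    obtain m z where mz: "m > 0" "norm z = 1" "\<And>v. v \<in> E \<Longrightarrow> t < norm (T v) \<Longrightarrow> ip z v = 0"
        "T z = m *\<^sub>R z" "norm (T x) \<le> m * norm x"
      using max_eigenvalue[OF T, of "{v\<in>E. t < norm (T v)}" x] x False eig' by blast
    have "m \<le> t"
    proof (rule ccontr)
      assume m: "\<not> m \<le> t"
      \<comment> \<open>If \<open>m > t\<close>, then \<open>z\<close> is also orthogonal to the
        eigenvectors with eigenvalue at most \<open>t\<close>, because those eigenvalues differ from
        \<open>m\<close>. So \<open>z\<close> could be added to \<open>E\<close>, against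
        maximality.\<close>
      have zv: "ip z v = 0" if v: "v \<in> E" for v
      proof (cases "t < norm (T v)")
        case False
        have "m *\<^sub>R ip z v = norm (T v) *\<^sub>R ip z v"
          using ip_T[OF v, of z] by (simp add: mz ip_scaleR_left)
        then show ?thesis
          using False m by auto
      qed (use mz v in blast)
      have "insert z E \<in> A"
        using E mz(1,2,4) zv ip_orth_sym by (auto simp: A_def)
      then have "z \<in> E"
        using max by blast
      then show False
        using zv[of z] mz(2) by (simp add: ip_norm)
    qed
    then have "m * norm x \<le> t * norm x"
      by (rule mult_right_mono) simp
    then show ?thesis
      using mz(5) by simp
  qed
  have bl: "bounded_linear T"
    by (rule bounded_linear_compact_operator[OF T(1)])
  have "g (T x) = 0" if g: "functional g" and g0: "\<And>v. v \<in> E \<Longrightarrow> g v = 0" for g x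
  proof -
    have blg: "bounded_linear g" and g_smul: "g (smul c y) = c * g y" for c y
      using g by (auto simp: functional_def)
    obtain B where B: "B > 0" "\<And>y. norm (g y) \<le> norm y * B"
      using bounded_linear.pos_bounded[OF blg] by blast
    \<comment> \<open>Subtract the projection \<open>p\<close> onto the eigenvectors above
      \<open>t\<close>: \<open>g\<close> kills \<open>T p\<close>, a combination of members of
      \<open>E\<close>, and \<open>small\<close> bounds the rest. Afterwards \<open>t\<close> is
      made arbitrarily small.\<close>
    have le: "norm (g (T x)) \<le> t * (norm x * B)" if t: "t > 0" for t
    proof -
      let ?J = "{v\<in>E. t < norm (T v)}"
      have on': "orthonormal_on ?J (\<lambda>v. v)"
        by (rule orthonormal_on_subset[OF on]) auto
      define p where "p = (\<Sum>v\<in>?J. smul (ip x v) v)"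
      have "g (T p) = (\<Sum>v\<in>?J. g (T (smul (ip x v) v)))"
        unfolding p_def using bl blg by (simp add: linear_sum bounded_linear.linear)
      also have "\<dots> = 0"
      proof (intro sum.neutral ballI)
        fix v assume v: "v \<in> ?J"
        then have "T (smul (ip x v) v) = smul (ip x v * of_real (norm (T v))) v"
          using eig'[of v] by (metis (no_types, lifting) compact_operator_smul[OF T(1)] mem_Collect_eq scale_scale)
        then show "g (T (smul (ip x v) v)) = 0"
          using g0[of v] v by (simp add: g_smul)
      qed
      finally have "g (T x) = g (T (x - p))"
        using bl blg by (simp add: linear_diff bounded_linear.linear)
      then have "norm (g (T x)) \<le> norm (T (x - p)) * B"
        using B(2)[of "T (x - p)"] by simp
      also have "norm (T (x - p)) \<le> t * norm (x - p)"
        by (rule small[OF t]) (unfold p_def, rule orth_proj_diff[OF on' fin[OF t]], simp)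
      also have "norm (x - p) \<le> norm x"
        unfolding p_def by (rule norm_orth_proj_diff_le[OF on' fin[OF t]])
      finally show ?thesis
        using t B(1) by (simp add: mult.assoc)
    qed
    have "norm (g (T x)) \<le> 0 + d" if d: "d > 0" for d
    proof -
      have b: "norm x * B \<ge> 0"
        using B(1) by simp
      \<comment> \<open>The added 1 keeps the denominator positive when
        \<open>x = 0\<close>.\<close>
      have "norm (g (T x)) \<le> d / (norm x * B + 1) * (norm x * B)"
        using b d by (intro le) simp
      also have "\<dots> \<le> d"
        using b d by (simp add: field_simps)
      finally show ?thesis by simp
    qed
    then have "norm (g (T x)) \<le> 0"
      by (rule field_le_epsilon)
    then show ?thesis
      by simp
  qed
  moreover have "Vector_Spaces.linear smul smul T"
    using T(1) by (simp add: compact_operator_def)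
  ultimately have "eigen_system smul ip T E (\<lambda>v. v) (\<lambda>v. norm (T v))"
    using on fin pos eig' ip_T hilbert_space_axioms
    by (intro eigen_system.intro eigen_system_axioms.intro) (auto simp: scaleR_conv_of_real)
  then show ?thesis ..
qed

end

section \<open>Eigenvectors of a tensor product of operators\<close>

context hilbert_tensor_product
begin

lemma tens_add_left: "tens (x + x') y = tens x y + tens x' y"
  and tens_smul_left: "tens (smul1 c x) y = smul3 c (tens x y)"
  and tens_add_right: "tens x (y + y') = tens x y + tens x y'"
  and tens_smul_right: "tens x (smul2 c y) = smul3 c (tens x y)"
  using tens_linear_left tens_linear_right by (auto simp: Vector_Spaces.linear_iff)

lemma norm_tens: "norm (tens x y) = norm x * norm y"
proof -
  have "of_real ((norm (tens x y))\<^sup>2) = (of_real ((norm x * norm y)\<^sup>2) :: 'k)"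
    unfolding prod.ip_norm[symmetric] ip_tens left.ip_norm right.ip_norm
    by (simp add: power_mult_distrib)
  then have "(norm (tens x y))\<^sup>2 = (norm x * norm y)\<^sup>2"
    by (simp only: of_real_eq_iff)
  then show ?thesis
    by (rule power2_eq_imp_eq) auto
qed

text \<open>Boundedness comes from \<open>norm_tens\<close>. Freezing one factor in this way reduces
  \<open>total\<close> for the tensor product to \<open>total\<close> in each factor.\<close>

lemma functional_tens_left:
  assumes "prod.functional g"
  shows "left.functional (\<lambda>x. g (tens x y))"
proof -
  have "bounded_linear (\<lambda>x. tens x y)"
    by (rule bounded_linear_intro[where K = "norm y"])
      (simp_all add: tens_add_left norm_tens flip: left.smul_of_real prod.smul_of_real tens_smul_left)
  then show ?thesis
    using assms bounded_linear_compose
    unfolding left.functional_def prod.functional_def by (auto simp: tens_smul_left)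
qed

lemma functional_tens_right:
  assumes "prod.functional g"
  shows "right.functional (\<lambda>y. g (tens x y))"
proof -
  have "bounded_linear (\<lambda>y. tens x y)"
    by (rule bounded_linear_intro[where K = "norm x"])
      (simp_all add: tens_add_right norm_tens mult.commute flip: right.smul_of_real prod.smul_of_real tens_smul_right)
  then show ?thesis
    using assms bounded_linear_compose
    unfolding right.functional_def prod.functional_def by (auto simp: tens_smul_right)
qed

text \<open>The kernel is a closed subspace containing the elementary tensors, whose span is dense.
  Identities that are linear and continuous in \<open>z\<close> thus need checking on elementary
  tensors only.\<close>

lemma functional_eq_zero:
  assumes g: "prod.functional g" "\<And>x y. g (tens x y) = 0"
  shows "g z = 0"
proof -
  have blg: "bounded_linear g" and g_smul: "g (smul3 c z) = c * g z" for c z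
    using g(1) by (auto simp: prod.functional_def)
  have "prod.span {tens x y |x y. True} \<subseteq> {z. g z = 0}"
  proof (rule prod.span_minimal)
    show "prod.subspace {z. g z = 0}"
      unfolding prod.subspace_def using blg
      by (auto simp: g_smul linear_add linear_0 bounded_linear.linear)
  qed (use g(2) in auto)
  moreover have "closed {z. g z = 0}"
    by (intro closed_Collect_eq continuous_intros linear_continuous_on blg)
  ultimately have "closure (prod.span {tens x y |x y. True}) \<subseteq> {z. g z = 0}"
    by (rule closure_minimal)
  then show ?thesis
    unfolding dense_tens by auto
qed

lemma eigen_system_tensor:
  fixes I :: "'i set" and J :: "'j set"
  assumes "eigen_system smul1 ip1 T I e l" "eigen_system smul2 ip2 T' J f m"
    and U: "tensor_operator smul3 tens T T' U"
  shows "eigen_system smul3 ip3 U (I \<times> J) (\<lambda>(i, j). tens (e i) (f j)) (\<lambda>(i, j). l i * m j)"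
proof -
  interpret S: eigen_system smul1 ip1 T I e l by fact
  interpret S': eigen_system smul2 ip2 T' J f m by fact
  have U_lin: "Vector_Spaces.linear smul3 smul3 U" and U_bl: "bounded_linear U"
    and U_tens: "U (tens x y) = tens (T x) (T' y)" for x y
    using U by (auto simp: tensor_operator_def)
  have U_smul: "U (smul3 c z) = smul3 c (U z)" for c z
    using U_lin by (auto simp: Vector_Spaces.linear_iff)
  have fun_U: "prod.functional (\<lambda>z. g (U z))" if "prod.functional g" for g
    using that bounded_linear_compose[OF _ U_bl] by (auto simp: prod.functional_def U_smul)
  show ?thesis
  proof (intro eigen_system.intro eigen_system_axioms.intro)
    show "hilbert_space smul3 ip3" ..
    show "Vector_Spaces.linear smul3 smul3 U" by fact
    show "prod.orthonormal_on (I \<times> J) (\<lambda>(i, j). tens (e i) (f j))"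
      unfolding prod.orthonormal_on_def
      using left.orthonormal_onD[OF S.orthonormal] right.orthonormal_onD[OF S'.orthonormal]
      by (auto simp: ip_tens)
  next
    fix ij assume "ij \<in> I \<times> J"
    then obtain i j where ij: "ij = (i, j)" "i \<in> I" "j \<in> J" by auto
    show "0 < (case ij of (i, j) \<Rightarrow> l i * m j)"
      using ij S.l_pos S'.l_pos by simp
    show "U (case ij of (i, j) \<Rightarrow> tens (e i) (f j)) =
        smul3 (of_real (case ij of (i, j) \<Rightarrow> l i * m j)) (case ij of (i, j) \<Rightarrow> tens (e i) (f j))"
      using ij by (simp add: U_tens S.T_e S'.T_e tens_smul_left tens_smul_right mult.commute)
    fix z
    \<comment> \<open>Both sides of the desired identity are bounded functionals of
      \<open>z\<close>; on elementary tensors it factors into the identities \<open>ip_T_e\<close>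
      of the two systems.\<close>
    have "prod.functional (\<lambda>z. ip3 (U z) (tens (e i) (f j)) - of_real (l i * m j) * ip3 z (tens (e i) (f j)))"
      using fun_U[OF prod.functional_ip, of "tens (e i) (f j)"] prod.functional_ip[of "tens (e i) (f j)"]
      by (auto simp: prod.functional_def algebra_simps
          intro!: bounded_linear_sub bounded_linear_const_mult)
    then have "ip3 (U z) (tens (e i) (f j)) - of_real (l i * m j) * ip3 z (tens (e i) (f j)) = 0"
      by (rule functional_eq_zero) (simp add: U_tens ip_tens S.ip_T_e S'.ip_T_e ij)
    then show "ip3 (U z) (case ij of (i, j) \<Rightarrow> tens (e i) (f j)) =
        of_real (case ij of (i, j) \<Rightarrow> l i * m j) * ip3 z (case ij of (i, j) \<Rightarrow> tens (e i) (f j))"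
      using ij by simp
  next
    fix t :: real assume t: "t > 0"
    \<comment> \<open>\<open>a\<close> and \<open>b\<close> bound all eigenvalues of the two
      factors: only finitely many exceed 1, and the inserted 1 covers the others. A product above
      \<open>t\<close> then forces \<open>l i > t / b\<close> and
      \<open>m j > t / a\<close>.\<close>
    define a where "a = Max (insert 1 (l ` {i\<in>I. 1 < l i}))"
    define b where "b = Max (insert 1 (m ` {j\<in>J. 1 < m j}))"
    have fin: "finite (insert 1 (l ` {i\<in>I. 1 < l i}))" "finite (insert 1 (m ` {j\<in>J. 1 < m j}))"
      using S.finite_level[of 1] S'.finite_level[of 1] by auto
    have ab: "a \<ge> 1" "b \<ge> 1"
      unfolding a_def b_def by (rule Max_ge[OF fin(1)] Max_ge[OF fin(2)]; simp)+
    have la: "l i \<le> a" if "i \<in> I" for i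
      using ab(1) Max_ge[OF fin(1), of "l i"] that unfolding a_def[symmetric] by (cases "1 < l i") auto
    have mb: "m j \<le> b" if "j \<in> J" for j
      using ab(2) Max_ge[OF fin(2), of "m j"] that unfolding b_def[symmetric] by (cases "1 < m j") auto
    have "{ij \<in> I \<times> J. t < (case ij of (i, j) \<Rightarrow> l i * m j)} \<subseteq>
        {i\<in>I. t / b < l i} \<times> {j\<in>J. t / a < m j}"
    proof safe
      fix i j assume ij: "i \<in> I" "j \<in> J" "t < l i * m j"
      have "l i * m j \<le> l i * b" "l i * m j \<le> a * m j"
        using la[OF ij(1)] mb[OF ij(2)] S.l_pos[OF ij(1)] S'.l_pos[OF ij(2)]
        by (auto intro!: mult_left_mono mult_right_mono)
      then show "t / b < l i" "t / a < m j"
        using ij(3) ab by (auto simp: field_simps)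
    qed
    moreover have "finite ({i\<in>I. t / b < l i} \<times> {j\<in>J. t / a < m j})"
      using t ab by (intro finite_cartesian_product S.finite_level S'.finite_level) auto
    ultimately show "finite {ij \<in> I \<times> J. t < (case ij of (i, j) \<Rightarrow> l i * m j)}"
      by (rule finite_subset)
  next
    fix g z
    assume g: "prod.functional g"
      and g0: "\<And>ij. ij \<in> I \<times> J \<Longrightarrow> g (case ij of (i, j) \<Rightarrow> tens (e i) (f j)) = 0"
    \<comment> \<open>First \<open>f j\<close> is frozen and \<open>total\<close> used in the first
      factor; then \<open>T x\<close> is frozen and \<open>total\<close> used in the second.\<close>
    have "g (tens (T x) (f j)) = 0" if "j \<in> J" for x j
      using S.total[OF functional_tens_left[OF g]] g0 that by force
    then have "g (tens (T x) (T' y)) = 0" for x y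
      using S'.total[OF functional_tens_right[OF g]] by blast
    then show "g (U z) = 0"
      using functional_eq_zero[OF fun_U[OF g]] by (simp add: U_tens)
  qed
qed

end

section \<open>Stieltjes integrals and summation by parts\<close>

lemma C2_on_pos_mono_derivative:
  assumes "C2_on_pos f" "mono_on {0<..} f"
  obtains f' where "\<And>x. x > 0 \<Longrightarrow> (f has_real_derivative f' x) (at x)" "continuous_on {0<..} f'"
    "\<And>x. x > 0 \<Longrightarrow> f' x \<ge> 0"
proof -
  obtain f' f'' where f': "\<And>x. x > 0 \<Longrightarrow> (f has_real_derivative f' x) (at x)"
      "\<And>x. x > 0 \<Longrightarrow> (f' has_real_derivative f'' x) (at x)"
    using assms(1) by (auto simp: C2_on_pos_def)
  have "continuous_on {0<..} f'"
    using f'(2) by (intro DERIV_continuous_on) (auto intro: has_field_derivative_at_within)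
  moreover have "f' x \<ge> 0" if x: "x > 0" for x
    by (rule mono_on_imp_deriv_nonneg[OF assms(2) f'(1)[OF x]]) (use x in \<open>simp add: interior_open\<close>)
  ultimately show thesis
    using f'(1) that by blast
qed

text \<open>Half-open intervals are an intersection-stable generator of the Borel sets, and both
  measures give them the same finite mass.\<close>

lemma interval_measure_eq_density:
  assumes cont: "continuous_on UNIV F" and mono: "mono F"
    and D: "D \<in> borel_measurable borel" "\<And>x. D x \<ge> 0"
    and int: "\<And>c d. c \<le> d \<Longrightarrow> ((\<lambda>x. indicator {c<..d} x * D x) has_integral (F d - F c)) UNIV"
  shows "interval_measure F = density lborel (\<lambda>x. ennreal (D x))"
proof (rule measure_eqI_generator_eq[where \<Omega> = UNIV and E = "range (\<lambda>(a, b). {a <.. b::real})"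
      and A = "\<lambda>n. {- real n<..real n}"])
  have Ioc: "emeasure (interval_measure F) {c<..d} = ennreal (F d - F c)" if "c \<le> d" for c d
    using that cont mono
    by (intro emeasure_interval_measure_Ioc)
      (auto simp: mono_def continuous_on_eq_continuous_within intro: continuous_within_subset)
  show "Int_stable (range (\<lambda>(a, b). {a <.. b::real}))"
    unfolding Int_stable_def by (auto simp: image_iff)
  show "range (\<lambda>(a, b). {a <.. b::real}) \<subseteq> Pow UNIV"
    by simp
  show "sets (interval_measure F) = sigma_sets UNIV (range (\<lambda>(a, b). {a <.. b::real}))"
    "sets (density lborel (\<lambda>x. ennreal (D x))) = sigma_sets UNIV (range (\<lambda>(a, b). {a <.. b::real}))"
    by (simp_all add: borel_sigma_sets_Ioc)
  show "range (\<lambda>n. {- real n<..real n}) \<subseteq> range (\<lambda>(a, b). {a <.. b::real})"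
    by auto
  show "emeasure (interval_measure F) {- real n<..real n} \<noteq> \<infinity>" for n
    by (simp add: Ioc)
  show "(\<Union>n. {- real n<..real n}) = UNIV"
  proof safe
    fix x :: real
    obtain n where "\<bar>x\<bar> < real n"
      using reals_Archimedean2 by blast
    then show "x \<in> (\<Union>n. {- real n<..real n})"
      by (auto intro!: exI[of _ n])
  qed simp
  fix X assume "X \<in> range (\<lambda>(a, b). {a <.. b::real})"
  then obtain c d where X: "X = {c<..d}" by auto
  show "emeasure (interval_measure F) X = emeasure (density lborel (\<lambda>x. ennreal (D x))) X"
  proof (cases "c \<le> d")
    case True
    have "emeasure (density lborel (\<lambda>x. ennreal (D x))) X
        = (\<integral>\<^sup>+x. ennreal (indicator {c<..d} x * D x) \<partial>lborel)"
      using D by (simp add: X emeasure_density) (auto intro!: nn_integral_cong split: split_indicator)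
    also have "\<dots> = ennreal (F d - F c)"
      by (rule nn_integral_has_integral_lborel[OF _ _ int[OF True]]) (use D in auto)
    finally show ?thesis
      using Ioc[OF True] X by simp
  qed (simp add: X)
qed

text \<open>Clamping the argument of \<open>F\<close> to \<open>[a, b]\<close> gives a distribution
  function whose density is \<open>F'\<close> on \<open>[a, b]\<close> and 0 elsewhere.\<close>

lemma stieltjes_integral_eq_integral:
  assumes F: "\<And>x. x \<in> {a..b} \<Longrightarrow> (F has_real_derivative F' x) (at x)"
    and F': "continuous_on {a..b} F'" "\<And>x. x \<in> {a..b} \<Longrightarrow> F' x \<ge> 0"
    and f: "continuous_on {a..b} f" and ab: "a \<le> b"
  shows "stieltjes_integral F a b f = integral {a..b} (\<lambda>x. f x * F' x)"
proof -
  define P where "P = (\<lambda>x. max a (min b x))"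
  define D where "D = (\<lambda>x. indicator {a..b} x *\<^sub>R F' x)"
  have P: "P x \<in> {a..b}" for x
    using ab by (auto simp: P_def)
  have cont_F: "continuous_on {a..b} F"
    using F by (intro DERIV_continuous_on) (auto intro: has_field_derivative_at_within)
  have ftc: "(F' has_integral (F d - F c)) {c..d}" if "a \<le> c" "c \<le> d" "d \<le> b" for c d
    using that F by (intro fundamental_theorem_of_calculus)
      (auto simp flip: has_real_derivative_iff_has_vector_derivative intro: has_field_derivative_at_within)
  have D: "D \<in> borel_measurable borel" "\<And>x. D x \<ge> 0"
    unfolding D_def using borel_measurable_continuous_on_indicator[OF _ F'(1)] F'(2)
    by (simp_all split: split_indicator)
  have mono_P: "P c \<le> P d" if "c \<le> d" for c d
    using that by (auto simp: P_def)
  have "interval_measure (\<lambda>x. F (P x)) = density lborel (\<lambda>x. ennreal (D x))"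
  proof (rule interval_measure_eq_density[OF _ _ D])
    have "continuous_on UNIV P"
      unfolding P_def by (intro continuous_intros)
    then show "continuous_on UNIV (\<lambda>x. F (P x))"
      by (rule continuous_on_compose2[OF cont_F]) (use P in blast)
    show "mono (\<lambda>x. F (P x))"
    proof
      fix c d :: real assume "c \<le> d"
      then have le: "P c \<le> P d" by (rule mono_P)
      have "0 \<le> F (P d) - F (P c)"
        by (rule has_integral_nonneg[OF ftc[OF _ le]]) (use P[of c] P[of d] F'(2) in auto)
      then show "F (P c) \<le> F (P d)" by simp
    qed
    fix c d :: real assume cd: "c \<le> d"
    have "((\<lambda>x. if x \<in> {P c..P d} then F' x else 0) has_integral (F (P d) - F (P c))) UNIV"
      unfolding has_integral_restrict_UNIV
      by (rule ftc) (use P[of c] P[of d] mono_P[OF cd] in auto)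
    \<comment> \<open>The two integrands can differ only at \<open>a\<close>, \<open>b\<close>,
      \<open>c\<close> and \<open>d\<close>.\<close>
    then show "((\<lambda>x. indicator {c<..d} x * D x) has_integral (F (P d) - F (P c))) UNIV"
      by (rule has_integral_spike_finite[of "{a, b, c, d}", rotated 2])
        (auto simp: D_def P_def max_def min_def split: split_indicator if_splits)
  qed
  then have "stieltjes_integral F a b f = (\<integral>x. indicator {a..b} x *\<^sub>R f x \<partial>density lborel (\<lambda>x. ennreal (D x)))"
    using ab by (simp add: stieltjes_integral_def P_def set_lebesgue_integral_def)
  also have "\<dots> = (\<integral>x. D x *\<^sub>R (indicator {a..b} x *\<^sub>R f x) \<partial>lborel)"
    using D borel_measurable_continuous_on_indicator[OF _ f] by (intro integral_density) simp_all
  also have "\<dots> = set_lebesgue_integral lborel {a..b} (\<lambda>x. f x * F' x)"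
    unfolding set_lebesgue_integral_def D_def
    by (intro Bochner_Integration.integral_cong) (auto split: split_indicator)
  also have "\<dots> = integral {a..b} (\<lambda>x. f x * F' x)"
    using F' f by (intro set_borel_integral_eq_integral borel_integrable_atLeastAtMost' continuous_intros)
  finally show ?thesis .
qed

lemma stieltjes_integral_mono:
  assumes F: "C2_on_pos F" "mono_on {0<..} F"
    and fg: "continuous_on {0<..} f" "continuous_on {0<..} g"
      "\<And>x. x > 0 \<Longrightarrow> 0 \<le> g x" "\<And>x. x > 0 \<Longrightarrow> f x \<le> g x"
    and ab: "0 < a'" "a' \<le> a" "b \<le> b'"
  shows "stieltjes_integral F a b f \<le> stieltjes_integral F a' b' g"
proof -
  obtain F' where F': "\<And>x. x > 0 \<Longrightarrow> (F has_real_derivative F' x) (at x)" "continuous_on {0<..} F'"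
    "\<And>x. x > 0 \<Longrightarrow> F' x \<ge> 0"
    by (rule C2_on_pos_mono_derivative[OF F]) (rule that)
  have eq: "stieltjes_integral F c d h = integral {c..d} (\<lambda>x. h x * F' x)"
    and int: "(\<lambda>x. h x * F' x) integrable_on {c..d}"
    if "0 < c" "c \<le> d" "continuous_on {0<..} h" for c d h
  proof -
    have sub: "{c..d} \<subseteq> {0<..}" using that by auto
    then show "stieltjes_integral F c d h = integral {c..d} (\<lambda>x. h x * F' x)"
      using F' that by (intro stieltjes_integral_eq_integral)
        (auto intro: continuous_on_subset)
    show "(\<lambda>x. h x * F' x) integrable_on {c..d}"
      using that(3) F'(2) by (intro integrable_continuous_real continuous_intros continuous_on_subset[OF _ sub])
  qed
  show ?thesis
  proof (cases "a \<le> b")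
    case True
    have "stieltjes_integral F a b f = integral {a..b} (\<lambda>x. f x * F' x)"
      using True ab fg by (intro eq) auto
    also have "\<dots> \<le> integral {a..b} (\<lambda>x. g x * F' x)"
      using True ab fg F'(3) by (intro integral_le int) (auto intro!: mult_right_mono)
    also have "\<dots> \<le> integral {a'..b'} (\<lambda>x. g x * F' x)"
      using True ab fg F'(3) by (intro integral_subset_le int) auto
    also have "\<dots> = stieltjes_integral F a' b' g"
      using True ab fg by (intro eq[symmetric]) auto
    finally show ?thesis .
  next
    case False
    \<comment> \<open>An integral with reversed limits is 0 by convention, so it remains to see that
      the other side is nonnegative.\<close>
    then have 0: "stieltjes_integral F a b f = 0"
      by (simp add: stieltjes_integral_def)
    have "0 \<le> stieltjes_integral F a' b' g"
    proof (cases "a' \<le> b'")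
      case True
      then show ?thesis
        using ab(1) fg(2) fg(3) F'(3) by (simp add: eq) (intro integral_nonneg int; force)
    qed (simp add: stieltjes_integral_def)
    then show ?thesis
      using 0 by simp
  qed
qed

text \<open>
  Summation by parts: the jump measure of the counting function of \<open>s\<close> and the measure
  \<open>A * d\<psi>\<close> are compared through the difference of their distribution functions.
\<close>

lemma sum_minus_integral_by_parts:
  fixes s :: "'j \<Rightarrow> real" and G G' \<psi> \<psi>' :: "real \<Rightarrow> real"
  defines "n \<equiv> \<lambda>J x. real (card {j\<in>J. s j < x})"
  assumes ab: "a \<le> b"
    and G: "\<And>x. x \<in> {a..b} \<Longrightarrow> (G has_real_derivative G' x) (at x)"
    and \<psi>: "\<And>x. x \<in> {a..b} \<Longrightarrow> (\<psi> has_real_derivative \<psi>' x) (at x)" "continuous_on {a..b} \<psi>'"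
    and J: "finite J" "\<And>j. j \<in> J \<Longrightarrow> s j < b"
  shows "((\<lambda>x. - G' x * (n J x - A * \<psi> x)) has_integral
    (\<Sum>j | j \<in> J \<and> a \<le> s j. G (s j)) - A * integral {a..b} (\<lambda>x. G x * \<psi>' x)
      - G b * (n J b - A * \<psi> b) + G a * (n J a - A * \<psi> a)) {a..b}"
proof -
  have ftc: "(G' has_integral (G b - G c)) {c..b}" if "a \<le> c" "c \<le> b" for c
    using that G by (intro fundamental_theorem_of_calculus)
      (auto simp flip: has_real_derivative_iff_has_vector_derivative intro: has_field_derivative_at_within)
  \<comment> \<open>The index \<open>j\<close> is counted beyond \<open>s j\<close>, so it
    contributes the integral of \<open>G'\<close> over \<open>[max a (s j), b]\<close>; strictness
    of the inequality matters only at the single point \<open>s j\<close>.\<close>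
  have "((\<lambda>x. if s j < x then G' x else 0) has_integral (G b - G (max a (s j)))) {a..b}" if j: "j \<in> J" for j
  proof -
    have "((\<lambda>x. if x \<in> {max a (s j)..b} then G' x else 0) has_integral (G b - G (max a (s j)))) {a..b}"
      using ab J(2)[OF j] by (subst has_integral_restrict) (auto intro!: ftc)
    then show ?thesis
      by (rule has_integral_spike_finite[of "{s j}", rotated 2]) auto
  qed
  then have "((\<lambda>x. \<Sum>j\<in>J. if s j < x then G' x else 0) has_integral (\<Sum>j\<in>J. G b - G (max a (s j)))) {a..b}"
    by (rule has_integral_sum[OF J(1)])
  moreover have "(\<Sum>j\<in>J. if s j < x then G' x else 0) = n J x * G' x" for x
    using J(1) by (simp add: n_def sum.If_cases Int_def)
  moreover have "(\<Sum>j\<in>J. G b - G (max a (s j))) = G b * n J b - (\<Sum>j | j \<in> J \<and> a \<le> s j. G (s j)) - G a * n J a"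
  proof -
    \<comment> \<open>Indices with \<open>s j < a\<close> are already counted at the left end point;
      each contributes \<open>G a\<close>, which becomes the boundary term there.\<close>
    have "(\<Sum>j\<in>J. G (max a (s j))) = (\<Sum>j | j \<in> J \<and> a \<le> s j. G (max a (s j))) + (\<Sum>j | j \<in> J \<and> s j < a. G (max a (s j)))"
      using J(1) by (subst sum.union_disjoint[symmetric]) (auto intro!: sum.cong)
    also have "\<dots> = (\<Sum>j | j \<in> J \<and> a \<le> s j. G (s j)) + (\<Sum>j | j \<in> J \<and> s j < a. G a)"
      by (intro arg_cong2[where f = "(+)"] sum.cong) auto
    also have "\<dots> = (\<Sum>j | j \<in> J \<and> a \<le> s j. G (s j)) + G a * n J a"
      by (simp add: n_def)
    moreover have "{j\<in>J. s j < b} = J"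
      using J(2) by auto
    ultimately show ?thesis
      by (simp add: sum_subtractf n_def)
  qed
  ultimately have 1: "((\<lambda>x. n J x * G' x) has_integral
      (G b * n J b - (\<Sum>j | j \<in> J \<and> a \<le> s j. G (s j)) - G a * n J a)) {a..b}"
    by simp
  have 2: "((\<lambda>x. G' x * \<psi> x + G x * \<psi>' x) has_integral (G b * \<psi> b - G a * \<psi> a)) {a..b}"
  proof (rule fundamental_theorem_of_calculus[OF ab])
    fix x assume x: "x \<in> {a..b}"
    then have "((\<lambda>x. G x * \<psi> x) has_real_derivative (G' x * \<psi> x + G x * \<psi>' x)) (at x)"
      using G \<psi>(1) by (auto intro!: derivative_eq_intros)
    then show "((\<lambda>x. G x * \<psi> x) has_vector_derivative G' x * \<psi> x + G x * \<psi>' x) (at x within {a..b})"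
      by (simp flip: has_real_derivative_iff_has_vector_derivative add: has_field_derivative_at_within)
  qed
  have "continuous_on {a..b} G"
    using G by (intro DERIV_continuous_on) (auto intro: has_field_derivative_at_within)
  then have 3: "((\<lambda>x. G x * \<psi>' x) has_integral integral {a..b} (\<lambda>x. G x * \<psi>' x)) {a..b}"
    using \<psi>(2) by (intro integrable_integral integrable_continuous_real continuous_intros)
  have "((\<lambda>x. A * (G' x * \<psi> x + G x * \<psi>' x) - n J x * G' x - A * (G x * \<psi>' x)) has_integral
      A * (G b * \<psi> b - G a * \<psi> a) - (G b * n J b - (\<Sum>j | j \<in> J \<and> a \<le> s j. G (s j)) - G a * n J a)
      - A * integral {a..b} (\<lambda>x. G x * \<psi>' x)) {a..b}"
    by (intro has_integral_diff has_integral_mult_right 1 2 3)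
  then show ?thesis
    by (simp add: algebra_simps)
qed

section \<open>Limits at zero and constants close to one\<close>

lemma filterlim_mult_at_right_0:
  fixes c :: real
  assumes "c > 0"
  shows "filterlim (\<lambda>t. c * t) (at_right 0) (at_right 0)"
proof -
  have "((\<lambda>t. c * t) \<longlongrightarrow> 0) (at_right 0)"
    by (auto intro!: tendsto_eq_intros)
  moreover have "\<forall>\<^sub>F t in at_right 0. c * t \<in> {0<..} \<and> c * t \<noteq> 0"
    using eventually_at_right_less[of "0::real"] by eventually_elim (use assms in simp)
  ultimately show ?thesis
    unfolding filterlim_at by blast
qed

text \<open>The infimum of the feasible values plus \<open>\<epsilon>\<close> is feasible by upward
  closure, and the addend vanishes in the limit. This makes a single function of
  \<open>\<epsilon>\<close> out of statements for each fixed \<open>\<delta>\<close>.\<close>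

lemma ex_near_one:
  fixes C :: "real \<Rightarrow> real \<Rightarrow> bool"
  assumes up: "\<And>\<epsilon> x y. C \<epsilon> x \<Longrightarrow> x \<le> y \<Longrightarrow> C \<epsilon> y"
    and ge1: "\<And>\<epsilon> x. C \<epsilon> x \<Longrightarrow> x \<ge> 1"
    and ex: "\<And>\<epsilon>. \<epsilon> > 0 \<Longrightarrow> \<exists>x. C \<epsilon> x"
    and ev: "\<And>\<delta>. \<delta> > 0 \<Longrightarrow> \<forall>\<^sub>F \<epsilon> in at_right 0. C \<epsilon> (1 + \<delta>)"
  shows "\<exists>f. (\<forall>\<epsilon>>0. C \<epsilon> (f \<epsilon>)) \<and> (f \<longlongrightarrow> 1) (at_right 0)"
proof -
  define f where "f \<epsilon> = Inf {x. C \<epsilon> x} + \<epsilon>" for \<epsilon>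
  have bdd: "bdd_below {x. C \<epsilon> x}" for \<epsilon>
    using ge1 by (auto intro!: bdd_belowI)
  have C: "C \<epsilon> (f \<epsilon>)" if \<epsilon>: "\<epsilon> > 0" for \<epsilon>
  proof -
    have "Inf {x. C \<epsilon> x} < f \<epsilon>"
      using \<epsilon> by (simp add: f_def)
    then obtain x where "C \<epsilon> x" "x < f \<epsilon>"
      using cInf_lessD[of "{x. C \<epsilon> x}" "f \<epsilon>"] ex[OF \<epsilon>] by auto
    then show ?thesis
      using up by simp
  qed
  have pos: "\<forall>\<^sub>F \<epsilon> in at_right (0::real). \<epsilon> > 0"
    by (simp add: eventually_at_right_less)
  have "(f \<longlongrightarrow> 1) (at_right 0)"
  proof (rule order_tendstoI)
    fix y :: real assume y: "y < 1"
    show "\<forall>\<^sub>F \<epsilon> in at_right 0. y < f \<epsilon>"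
      using pos by eventually_elim (use C ge1 y in force)
  next
    fix y :: real assume y: "y > 1"
    define \<delta> where "\<delta> = (y - 1) / 2"
    have \<delta>: "\<delta> > 0" using y by (simp add: \<delta>_def)
    have "\<forall>\<^sub>F \<epsilon> in at_right 0. \<epsilon> < \<delta>"
      using \<delta> by (simp add: eventually_at_right_field) blast
    with ev[OF \<delta>] show "\<forall>\<^sub>F \<epsilon> in at_right 0. f \<epsilon> < y"
    proof eventually_elim
      case (elim \<epsilon>)
      then have "Inf {x. C \<epsilon> x} \<le> 1 + \<delta>"
        by (intro cInf_lower bdd) simp
      then show ?case
        using elim by (simp add: f_def \<delta>_def field_simps)
    qed
  qed
  with C show ?thesis by blast
qed

lemma asymp_equiv_ratio_bounds:
  fixes f g :: "real \<Rightarrow> real"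
  assumes "f \<sim>[F] g" "r > 1" "\<forall>\<^sub>F t in F. g t > 0"
  shows "\<forall>\<^sub>F t in F. f t \<le> r * g t \<and> g t / r \<le> f t"
proof -
  have "\<forall>\<^sub>F t in F. f t \<noteq> 0 \<or> g t \<noteq> 0"
    using assms(3) by (rule eventually_mono) auto
  then have lim: "((\<lambda>t. f t / g t) \<longlongrightarrow> 1) F"
    by (rule asymp_equivD_strong[OF assms(1)])
  have "\<forall>\<^sub>F t in F. f t / g t < r"
    using order_tendstoD(2)[OF lim] assms(2) by simp
  moreover have "\<forall>\<^sub>F t in F. 1 / r < f t / g t"
    using order_tendstoD(1)[OF lim] assms(2) by simp
  ultimately show ?thesis
    using assms(3) by eventually_elim (use assms(2) in \<open>auto simp: field_simps\<close>)
qed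

section \<open>Counting functions with slowly varying asymptotics\<close>

definition tail_count :: "'i set \<Rightarrow> ('i \<Rightarrow> real) \<Rightarrow> real \<Rightarrow> nat"
  where "tail_count I l t = card {i\<in>I. t < l i}"

text \<open>A spectrum without its operator: multiplicities are carried by the index set, and
  compactness survives as \<open>finite_level\<close>.\<close>

locale slowly_varying_spectrum =
  fixes I :: "'i set" and l :: "'i \<Rightarrow> real" and \<phi> :: "real \<Rightarrow> real"
  assumes pos: "i \<in> I \<Longrightarrow> l i > 0"
    and finite_level: "t > 0 \<Longrightarrow> finite {i\<in>I. t < l i}"
    and count_asymp: "(\<lambda>t. real (tail_count I l t)) \<sim>[at_right 0] (\<lambda>t. \<phi> (1 / t))"
    and mono: "mono_on {0<..} \<phi>"
    and C2: "C2_on_pos \<phi>"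
    and slowly_varying: "slowly_varying \<phi>"
begin

lemma \<phi>_pos: "x > 0 \<Longrightarrow> \<phi> x > 0"
  using slowly_varying by (simp add: slowly_varying_def)

lemma \<phi>_mono: "0 < x \<Longrightarrow> x \<le> y \<Longrightarrow> \<phi> x \<le> \<phi> y"
  using mono by (auto simp: mono_on_def)

lemma continuous_on_\<phi>: "continuous_on {0<..} \<phi>"
proof -
  obtain \<phi>' where "\<And>x. x > 0 \<Longrightarrow> (\<phi> has_real_derivative \<phi>' x) (at x)"
    by (rule C2_on_pos_mono_derivative[OF C2 mono]) (rule that)
  then show ?thesis
    by (intro DERIV_continuous_on) (auto intro: has_field_derivative_at_within)
qed

lemma continuous_on_\<phi>_divide: "c > 0 \<Longrightarrow> continuous_on {0<..} (\<lambda>x. \<phi> (c / x))"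
  by (rule continuous_on_compose2[OF continuous_on_\<phi>]) (auto intro!: continuous_intros)

lemma tail_count_antimono: "0 < s \<Longrightarrow> s \<le> t \<Longrightarrow> tail_count I l t \<le> tail_count I l s"
  unfolding tail_count_def by (intro card_mono finite_level) auto

lemma \<phi>_ratio_tendsto:
  assumes "c > 0"
  shows "((\<lambda>t. \<phi> (c / t) / \<phi> (1 / t)) \<longlongrightarrow> 1) (at_right 0)"
proof -
  have "((\<lambda>x. \<phi> (c * x) / \<phi> x) \<longlongrightarrow> 1) at_top"
    using slowly_varying assms by (simp add: slowly_varying_def)
  then have "((\<lambda>t. \<phi> (c * inverse t) / \<phi> (inverse t)) \<longlongrightarrow> 1) (at_right 0)"
    by (rule filterlim_compose[OF _ filterlim_inverse_at_top_right])
  then show ?thesis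
    by (simp add: field_simps)
qed

text \<open>Slow variation absorbs the scaling: the count at \<open>t / c\<close> is equivalent to
  \<open>\<phi> (c / t)\<close>, which is equivalent to \<open>\<phi> (1 / t)\<close>.\<close>

lemma tail_count_ratio_tendsto:
  assumes c: "c > 0"
  shows "((\<lambda>t. real (tail_count I l (t / c)) / \<phi> (1 / t)) \<longlongrightarrow> 1) (at_right 0)"
proof -
  have pos: "\<forall>\<^sub>F t in at_right (0::real). t > 0"
    by (simp add: eventually_at_right_less)
  then have "\<forall>\<^sub>F t in at_right 0. real (tail_count I l t) \<noteq> 0 \<or> \<phi> (1 / t) \<noteq> 0"
    by (rule eventually_mono) (use \<phi>_pos in \<open>simp add: less_imp_neq[symmetric]\<close>)
  then have "((\<lambda>t. real (tail_count I l t) / \<phi> (1 / t)) \<longlongrightarrow> 1) (at_right 0)"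
    by (rule asymp_equivD_strong[OF count_asymp])
  then have "((\<lambda>t. real (tail_count I l (inverse c * t)) / \<phi> (1 / (inverse c * t))) \<longlongrightarrow> 1) (at_right 0)"
    by (rule filterlim_compose[OF _ filterlim_mult_at_right_0]) (use c in simp)
  from tendsto_mult[OF this \<phi>_ratio_tendsto[OF c]]
  have "((\<lambda>t. real (tail_count I l (inverse c * t)) / \<phi> (1 / (inverse c * t)) *
      (\<phi> (c / t) / \<phi> (1 / t))) \<longlongrightarrow> 1) (at_right 0)"
    by simp
  then show ?thesis
  proof (rule Lim_transform_eventually)
    show "\<forall>\<^sub>F t in at_right 0. real (tail_count I l (inverse c * t)) / \<phi> (1 / (inverse c * t)) *
        (\<phi> (c / t) / \<phi> (1 / t)) = real (tail_count I l (t / c)) / \<phi> (1 / t)"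
      using pos
    proof eventually_elim
      case (elim t)
      then have "\<phi> (c / t) > 0"
        using c by (intro \<phi>_pos) simp
      then show ?case
        using elim c by (simp add: field_simps)
    qed
  qed
qed

lemma eventually_tail_count_bounds:
  assumes "r > 1"
  shows "\<forall>\<^sub>F t in at_right 0. real (tail_count I l t) \<le> r * \<phi> (1 / t) \<and> \<phi> (1 / t) / r \<le> real (tail_count I l t)"
proof (rule asymp_equiv_ratio_bounds[OF count_asymp assms])
  show "\<forall>\<^sub>F t in at_right 0. \<phi> (1 / t) > 0"
    using eventually_at_right_less[of "0::real"] by eventually_elim (simp add: \<phi>_pos)
qed

text \<open>Between \<open>\<epsilon>'\<close> and \<open>\<epsilon>\<close> the count is at most
  its value at \<open>\<epsilon>'\<close> and \<open>\<phi> (1 / s)\<close> is at least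
  \<open>\<phi> (1 / \<epsilon>)\<close>, so the quotient of these extremes is a suitable constant.
  Up to \<open>\<epsilon>'\<close> the constant 2 works.\<close>

lemma ex_tail_count_bound:
  assumes "0 < \<epsilon>'" "\<epsilon>' \<le> \<epsilon>"
    and "\<And>s. 0 < s \<Longrightarrow> s \<le> \<epsilon>' \<Longrightarrow> real (tail_count I l s) \<le> 2 * \<phi> (1 / s)"
    and y: "2 + real (tail_count I l \<epsilon>') / \<phi> (1 / \<epsilon>) \<le> y"
    and s: "0 < s" "s \<le> \<epsilon>"
  shows "real (tail_count I l s) \<le> y * \<phi> (1 / s)"
proof -
  have p: "\<phi> (1 / \<epsilon>) > 0" "\<phi> (1 / s) > 0" "\<phi> (1 / \<epsilon>) \<le> \<phi> (1 / s)"
    using assms by (auto intro!: \<phi>_pos \<phi>_mono simp: field_simps)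
  have nn: "real (tail_count I l \<epsilon>') / \<phi> (1 / \<epsilon>) \<ge> 0"
    using p by simp
  have y': "2 \<le> y" "real (tail_count I l \<epsilon>') / \<phi> (1 / \<epsilon>) \<le> y"
    using nn y by linarith+
  show ?thesis
  proof (cases "s \<le> \<epsilon>'")
    case True
    then have "real (tail_count I l s) \<le> 2 * \<phi> (1 / s)"
      using assms(3) s by blast
    also have "\<dots> \<le> y * \<phi> (1 / s)"
      using p y' by (intro mult_right_mono) auto
    finally show ?thesis .
  next
    case False
    then have "real (tail_count I l s) \<le> real (tail_count I l \<epsilon>')"
      using tail_count_antimono assms(1) by simp
    also have "\<dots> = real (tail_count I l \<epsilon>') / \<phi> (1 / \<epsilon>) * \<phi> (1 / \<epsilon>)"
      using p by simp
    also have "\<dots> \<le> y * \<phi> (1 / s)"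
      using p y' by (intro mult_mono) auto
    finally show ?thesis .
  qed
qed

text \<open>Summation by parts in the variable \<open>x = 1 / l i\<close> with
  \<open>G x = F (1 / t / x)\<close>. As \<open>F\<close> is nondecreasing,
  \<open>- G' x \<ge> 0\<close>, so a one-sided comparison of the count with
  \<open>A * \<phi>\<close> fixes the sign of the remaining integral. The boundary term at
  \<open>\<epsilon> / t\<close> has the same sign and is dropped; the one at
  \<open>1 / \<epsilon>\<close> is kept exactly.\<close>

lemma sum_vs_stieltjes_integral:
  assumes t: "0 < t" "t / \<epsilon> \<le> \<epsilon>" "\<epsilon> > 0"
    and F: "C2_on_pos F" "mono_on {0<..} F" "\<And>x. x > 0 \<Longrightarrow> F x \<ge> 0"
  shows "(\<And>s. 0 < s \<Longrightarrow> s \<le> \<epsilon> \<Longrightarrow> real (tail_count I l s) \<le> A * \<phi> (1 / s)) \<Longrightarrow>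
      (\<Sum>i | i \<in> I \<and> t / \<epsilon> < l i \<and> l i \<le> \<epsilon>. F (l i / t)) \<le>
      A * stieltjes_integral \<phi> (1 / \<epsilon>) (\<epsilon> / t) (\<lambda>x. F (1 / t / x)) -
        F (\<epsilon> / t) * (tail_count I l \<epsilon> - A * \<phi> (1 / \<epsilon>))" (is "PROP ?A \<Longrightarrow> ?SA")
    and "(\<And>s. 0 < s \<Longrightarrow> s \<le> \<epsilon> \<Longrightarrow> A * \<phi> (1 / s) \<le> real (tail_count I l s)) \<Longrightarrow>
      A * stieltjes_integral \<phi> (1 / \<epsilon>) (\<epsilon> / t) (\<lambda>x. F (1 / t / x)) -
        F (\<epsilon> / t) * (tail_count I l \<epsilon> - A * \<phi> (1 / \<epsilon>)) \<le>
      (\<Sum>i | i \<in> I \<and> t / \<epsilon> < l i \<and> l i \<le> \<epsilon>. F (l i / t))" (is "PROP ?B \<Longrightarrow> ?SB")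
proof -
  obtain \<phi>' where \<phi>': "\<And>x. x > 0 \<Longrightarrow> (\<phi> has_real_derivative \<phi>' x) (at x)" "continuous_on {0<..} \<phi>'"
    "\<And>x. x > 0 \<Longrightarrow> \<phi>' x \<ge> 0"
    by (rule C2_on_pos_mono_derivative[OF C2 mono]) (rule that)
  obtain F' where F': "\<And>x. x > 0 \<Longrightarrow> (F has_real_derivative F' x) (at x)"
    "\<And>x. x > 0 \<Longrightarrow> F' x \<ge> 0"
    by (rule C2_on_pos_mono_derivative[OF F(1,2)]) (rule that)
  define a b where "a = 1 / \<epsilon>" and "b = \<epsilon> / t"
  define J where "J = {i\<in>I. t / \<epsilon> < l i}"
  define s where "s i = 1 / l i" for i
  define G where "G x = F (1 / t / x)" for x
  define G' where "G' x = F' (1 / t / x) * (- 1 / (t * x\<^sup>2))" for x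
  define n where "n x = real (card {j\<in>J. s j < x})" for x
  have ab: "0 < a" "a \<le> b"
    using t by (auto simp: a_def b_def field_simps)
  have sub: "{a..b} \<subseteq> {0<..}"
    using ab by auto
  have fin: "finite J"
    unfolding J_def using t by (intro finite_level) simp
  \<comment> \<open>Restricting to \<open>l i > t / \<epsilon>\<close> loses nothing for
    \<open>x \<le> b\<close>, since then \<open>1 / x \<ge> t / \<epsilon>\<close>.\<close>
  have n: "n x = real (tail_count I l (1 / x))" if "x \<in> {a..b}" for x
  proof -
    have x: "x > 0" "t / \<epsilon> \<le> 1 / x"
      using that ab t by (auto simp: b_def field_simps)
    have "s i < x \<longleftrightarrow> 1 / x < l i" if "i \<in> I" for i
      using x(1) pos[OF that] by (simp add: s_def field_simps)
    then have "{j\<in>J. s j < x} = {i\<in>I. 1 / x < l i}"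
      using x(2) le_less_trans unfolding J_def by blast
    then show ?thesis
      by (simp add: n_def tail_count_def)
  qed
  have G_deriv: "(G has_real_derivative G' x) (at x)" if "x \<in> {a..b}" for x
  proof -
    have x: "x > 0" using that ab by auto
    have "((\<lambda>x. 1 / t / x) has_real_derivative (- 1 / (t * x\<^sup>2))) (at x)"
      using x t by (auto intro!: derivative_eq_intros simp: power2_eq_square)
    then show ?thesis
      unfolding G_def G'_def using x t by (intro DERIV_chain2 F'(1)) auto
  qed
  have G'_le: "- G' x \<ge> 0" if "x \<in> {a..b}" for x
  proof -
    have "x > 0" using that ab by auto
    then show ?thesis
      unfolding G'_def using t F'(2)[of "1 / t / x"] by simp
  qed
  have G_ab: "G a = F (\<epsilon> / t)" "G b \<ge> 0"
    using t by (auto simp: G_def a_def b_def F(3))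
  have cont_G: "continuous_on {a..b} G"
    using G_deriv by (intro DERIV_continuous_on) (auto intro: has_field_derivative_at_within)
  have stieltjes: "stieltjes_integral \<phi> a b G = integral {a..b} (\<lambda>x. G x * \<phi>' x)"
    using \<phi>' sub ab cont_G by (intro stieltjes_integral_eq_integral) (auto intro: continuous_on_subset)
  have Sum: "(\<Sum>i | i \<in> I \<and> t / \<epsilon> < l i \<and> l i \<le> \<epsilon>. F (l i / t)) = (\<Sum>j | j \<in> J \<and> a \<le> s j. G (s j))"
  proof (rule sum.cong)
    have "a \<le> s i \<longleftrightarrow> l i \<le> \<epsilon>" if "i \<in> I" for i
      using pos[OF that] t(3) by (simp add: a_def s_def field_simps)
    then show "{i. i \<in> I \<and> t / \<epsilon> < l i \<and> l i \<le> \<epsilon>} = {j. j \<in> J \<and> a \<le> s j}"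
      unfolding J_def by blast
  qed (simp add: G_def s_def)
  have parts: "((\<lambda>x. - G' x * (n x - A * \<phi> x)) has_integral
    (\<Sum>j | j \<in> J \<and> a \<le> s j. G (s j)) - A * integral {a..b} (\<lambda>x. G x * \<phi>' x)
      - G b * (n b - A * \<phi> b) + G a * (n a - A * \<phi> a)) {a..b}"
    unfolding n_def
  proof (rule sum_minus_integral_by_parts[OF ab(2) G_deriv _ _ fin])
    show "\<And>x. x \<in> {a..b} \<Longrightarrow> (\<phi> has_real_derivative \<phi>' x) (at x)"
      using \<phi>'(1) sub by auto
    show "continuous_on {a..b} \<phi>'"
      by (rule continuous_on_subset[OF \<phi>'(2) sub])
    show "s j < b" if "j \<in> J" for j
    proof -
      have "l j > 0" "t / \<epsilon> < l j"
        using that pos by (auto simp: J_def)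
      then show ?thesis
        using t(1,3) by (simp add: s_def b_def field_simps)
    qed
  qed
  have n_ab: "n a = tail_count I l \<epsilon>" "n b = tail_count I l (1 / b)"
    using n ab t by (auto simp: a_def)
  have rng: "0 < 1 / x" "1 / x \<le> \<epsilon>" if x: "x \<in> {a..b}" for x
  proof -
    have "0 < x" "1 / \<epsilon> \<le> x"
      using x ab sub by (auto simp flip: a_def)
    then show "0 < 1 / x" "1 / x \<le> \<epsilon>"
      using t(3) by (simp_all add: field_simps)
  qed
  show ?SA if A: "PROP ?A"
  proof -
    have le: "n x - A * \<phi> x \<le> 0" if "x \<in> {a..b}" for x
      using A[of "1 / x"] rng[OF that] n[OF that] by simp
    have "(\<Sum>j | j \<in> J \<and> a \<le> s j. G (s j)) - A * integral {a..b} (\<lambda>x. G x * \<phi>' x)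
      - G b * (n b - A * \<phi> b) + G a * (n a - A * \<phi> a) \<le> 0"
      by (rule has_integral_le[OF parts has_integral_0]) (intro mult_nonneg_nonpos G'_le le)
    moreover have "G b * (n b - A * \<phi> b) \<le> 0"
      using ab by (intro mult_nonneg_nonpos le G_ab) simp
    ultimately show ?SA
      unfolding Sum G_ab(1)[symmetric] stieltjes[symmetric] n_ab(1)[symmetric]
      by (simp add: a_def b_def G_def[abs_def])
  qed
  show ?SB if B: "PROP ?B"
  proof -
    have le: "n x - A * \<phi> x \<ge> 0" if "x \<in> {a..b}" for x
      using B[of "1 / x"] rng[OF that] n[OF that] by simp
    have "0 \<le> (\<Sum>j | j \<in> J \<and> a \<le> s j. G (s j)) - A * integral {a..b} (\<lambda>x. G x * \<phi>' x)
      - G b * (n b - A * \<phi> b) + G a * (n a - A * \<phi> a)"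
      by (rule has_integral_nonneg[OF parts]) (intro mult_nonneg_nonneg G'_le le)
    moreover have "G b * (n b - A * \<phi> b) \<ge> 0"
      using ab by (intro mult_nonneg_nonneg le G_ab) simp
    ultimately show ?SB
      unfolding Sum G_ab(1)[symmetric] stieltjes[symmetric] n_ab(1)[symmetric]
      by (simp add: a_def b_def G_def[abs_def])
  qed
qed

end

section \<open>Counting products of eigenvalues\<close>

lemma clamp_error:
  fixes x :: real
  assumes "a \<le> b" "a - x \<le> d" "x - b \<le> d" "0 \<le> d"
  shows "\<bar>max a (min b x) - x\<bar> \<le> d"
  using assms by linarith

text \<open>
  Any value in \<open>[lo t, hi t]\<close> closest to \<open>p t * c\<close> will do for the sum \<open>S t + S' t\<close>; its distance
  from \<open>p t * c\<close> is split in the ratio \<open>p t : q t\<close>.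
\<close>

lemma split_error:
  fixes p q lo hi :: "real \<Rightarrow> real"
  assumes le: "\<And>t. t > 0 \<Longrightarrow> lo t \<le> hi t"
    and pos: "c > 0" "\<And>t. t > 0 \<Longrightarrow> p t > 0" "\<And>t. t > 0 \<Longrightarrow> q t > 0"
    and lo: "\<And>\<delta>. \<delta> > 0 \<Longrightarrow> \<forall>\<^sub>F t in at_right 0. lo t \<le> p t * (c + \<delta>) + \<delta> * q t"
    and hi: "\<And>\<delta>. \<delta> > 0 \<Longrightarrow> \<forall>\<^sub>F t in at_right 0. p t * (c - \<delta>) \<le> hi t"
  shows "\<exists>S S'. (\<forall>t>0. lo t \<le> S t + S' t \<and> S t + S' t \<le> hi t) \<and>
    S \<sim>[at_right 0] (\<lambda>t. p t * c) \<and> S' \<in> o[at_right 0](q)"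
proof -
  define e where "e t = max (lo t) (min (hi t) (p t * c)) - p t * c" for t
  define w where "w t = e t / (p t + q t)" for t
  define S where "S t = p t * c + w t * p t" for t
  define S' where "S' t = w t * q t" for t
  have gt0: "\<forall>\<^sub>F t in at_right (0::real). t > 0"
    by (simp add: eventually_at_right_less)
  have w: "(w \<longlongrightarrow> 0) (at_right 0)"
  proof (rule tendstoI)
    fix r :: real assume r: "r > 0"
    define \<delta> where "\<delta> = r / 2"
    have \<delta>: "\<delta> > 0" "\<delta> < r"
      using r by (auto simp: \<delta>_def)
    show "\<forall>\<^sub>F t in at_right 0. dist (w t) 0 < r"
      using lo[OF \<delta>(1)] hi[OF \<delta>(1)] gt0
    proof eventually_elim
      case (elim t)
      have pq: "p t > 0" "q t > 0" using pos elim by auto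
      \<comment> \<open>Both one-sided defects are at most \<open>d\<close>, so the clamped value
        misses \<open>p t * c\<close> by at most \<open>d\<close>; \<open>w t\<close> is this error
        in units of \<open>p t + q t\<close>.\<close>
      define d where "d = \<delta> * (p t + q t)"
      have "\<delta> * q t \<ge> 0" "d = \<delta> * p t + \<delta> * q t" "d \<ge> 0"
        using pq \<delta> by (auto simp: d_def distrib_left)
      moreover have "lo t - p t * c \<le> \<delta> * p t + \<delta> * q t" "p t * c - hi t \<le> \<delta> * p t"
        using elim by (auto simp: algebra_simps)
      ultimately have "lo t - p t * c \<le> d" "p t * c - hi t \<le> d" "d \<ge> 0"
        by linarith+
      then have "\<bar>e t\<bar> \<le> \<delta> * (p t + q t)"
        unfolding e_def d_def[symmetric] by (intro clamp_error le elim(3))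
      moreover have "\<bar>w t\<bar> = \<bar>e t\<bar> / (p t + q t)"
        using pq by (simp add: w_def)
      ultimately have "\<bar>w t\<bar> \<le> \<delta>"
        using pq by (simp add: pos_divide_le_eq)
      then show ?case
        using \<delta> by simp
    qed
  qed
  have sum: "S t + S' t = max (lo t) (min (hi t) (p t * c))" if "t > 0" for t
  proof -
    have "p t + q t > 0"
      using pos that by (simp add: add_pos_pos)
    then have "w t * (p t + q t) = e t"
      by (simp add: w_def)
    then show ?thesis
      by (simp add: S_def S'_def e_def algebra_simps)
  qed
  have "S \<sim>[at_right 0] (\<lambda>t. p t * c)"
  proof (rule asymp_equivI')
    have "((\<lambda>t. 1 + w t / c) \<longlongrightarrow> 1) (at_right 0)"
      using pos(1) w by (auto intro!: tendsto_eq_intros)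
    then show "((\<lambda>t. S t / (p t * c)) \<longlongrightarrow> 1) (at_right 0)"
    proof (rule Lim_transform_eventually)
      show "\<forall>\<^sub>F t in at_right 0. 1 + w t / c = S t / (p t * c)"
        using gt0 by eventually_elim
          (use pos in \<open>simp add: S_def field_simps less_imp_neq[symmetric]\<close>)
    qed
  qed
  moreover have "S' \<in> o[at_right 0](q)"
  proof (rule smalloI_tendsto)
    show "\<forall>\<^sub>F t in at_right 0. q t \<noteq> 0"
      using gt0 by eventually_elim (use pos in \<open>simp add: less_imp_neq[symmetric]\<close>)
    show "((\<lambda>t. S' t / q t) \<longlongrightarrow> 0) (at_right 0)"
      using w
    proof (rule Lim_transform_eventually)
      show "\<forall>\<^sub>F t in at_right 0. w t = S' t / q t"
        using gt0 by eventually_elim (use pos in \<open>simp add: S'_def less_imp_neq[symmetric]\<close>)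
    qed
  qed
  moreover have "\<forall>t>0. lo t \<le> S t + S' t \<and> S t + S' t \<le> hi t"
    using le by (auto simp: sum)
  ultimately show ?thesis
    by blast
qed

section \<open>Splitting the count of products by the size of \<open>m j\<close>\<close>

locale slowly_varying_spectrum_pair =
  S: slowly_varying_spectrum I l \<phi> + S': slowly_varying_spectrum J m \<psi>
  for I :: "'i set" and l \<phi> and J :: "'j set" and m \<psi>
begin

definition product_count :: "real \<Rightarrow> nat"
  where "product_count t = tail_count (I \<times> J) (\<lambda>(i, j). l i * m j) t"

definition large_part :: "real \<Rightarrow> real \<Rightarrow> real"
  where "large_part \<epsilon> t = (\<Sum>j | j \<in> J \<and> \<epsilon> < m j. real (tail_count I l (t / m j)))"

definition middle_part :: "real \<Rightarrow> real \<Rightarrow> real"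
  where "middle_part \<epsilon> t = (\<Sum>j | j \<in> J \<and> t / \<epsilon> < m j \<and> m j \<le> \<epsilon>. real (tail_count I l (t / m j)))"

text \<open>The term for \<open>i\<close> counts the \<open>j\<close> with
  \<open>t / l i < m j \<le> t / \<epsilon>\<close>. As a difference of two counts it can be
  compared with \<open>\<psi> (1 / t)\<close> term by term.\<close>

definition small_part :: "real \<Rightarrow> real \<Rightarrow> real"
  where "small_part \<epsilon> t = (\<Sum>i | i \<in> I \<and> \<epsilon> < l i.
    real (tail_count J m (t / l i)) - real (tail_count J m (t / \<epsilon>)))"

text \<open>The integral of the two estimates with both constants set to 1; theirs are compared with
  it by monotonicity.\<close>

definition main_integral :: "real \<Rightarrow> real \<Rightarrow> real"
  where "main_integral \<epsilon> t = stieltjes_integral \<psi> (1 / \<epsilon>) (\<epsilon> / t) (\<lambda>\<sigma>. \<phi> (1 / t / \<sigma>))"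

text \<open>Pairs with \<open>m j > t / \<epsilon>\<close> are counted by \<open>j\<close> and fall
  into the large and the middle part. If \<open>m j \<le> t / \<epsilon>\<close>, a product above
  \<open>t\<close> forces \<open>l i > \<epsilon>\<close>, so these pairs are counted by
  \<open>i\<close>.\<close>

lemma product_count_decomposition:
  assumes t: "0 < t" "t / \<epsilon> \<le> \<epsilon>" "\<epsilon> > 0"
  shows "real (product_count t) = large_part \<epsilon> t + middle_part \<epsilon> t + small_part \<epsilon> t"
proof -
  define J1 where "J1 = {j\<in>J. t / \<epsilon> < m j}"
  define I1 where "I1 = {i\<in>I. \<epsilon> < l i}"
  define X where "X j = {i\<in>I. t / m j < l i}" for j
  define Y where "Y i = {j\<in>J. t / l i < m j \<and> m j \<le> t / \<epsilon>}" for i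
  have te: "t / \<epsilon> > 0"
    using t by simp
  have fin: "finite J1" "finite I1"
    unfolding J1_def I1_def using t te by (auto intro: S.finite_level S'.finite_level)
  have fX: "finite (X j)" if "j \<in> J1" for j
    unfolding X_def using that t(1) S'.pos by (intro S.finite_level) (auto simp: J1_def)
  have fY: "finite (Y i)" if "i \<in> I1" for i
  proof -
    have "finite {j\<in>J. t / l i < m j}"
      using that t(1) S.pos by (intro S'.finite_level) (auto simp: I1_def)
    then show ?thesis
      by (rule rev_finite_subset) (auto simp: Y_def)
  qed
  have iff: "t < l i * m j \<longleftrightarrow> t / m j < l i" "t < l i * m j \<longleftrightarrow> t / l i < m j" if "i \<in> I" "j \<in> J" for i j
    using S.pos[OF that(1)] S'.pos[OF that(2)] by (simp_all add: field_simps)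
  have imp: "\<epsilon> < l i" if "i \<in> I" "j \<in> J" "t < l i * m j" "m j \<le> t / \<epsilon>" for i j
  proof -
    have "t < l i * (t / \<epsilon>)"
      using that(3) mult_left_mono[OF that(4), of "l i"] S.pos[OF that(1)] by simp
    then show ?thesis
      using t by (simp add: field_simps)
  qed
  have set_eq: "{ij \<in> I \<times> J. t < (case ij of (i, j) \<Rightarrow> l i * m j)} =
      prod.swap ` Sigma J1 X \<union> Sigma I1 Y" (is "?L = ?R")
  proof
    show "?L \<subseteq> ?R"
    proof
      fix ij assume "ij \<in> ?L"
      then obtain i j where ij: "ij = (i, j)" "i \<in> I" "j \<in> J" "t < l i * m j"
        by auto
      show "ij \<in> ?R"
      proof (cases "t / \<epsilon> < m j")
        case True
        then have "(j, i) \<in> Sigma J1 X"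
          using ij iff(1)[OF ij(2,3)] by (simp add: J1_def X_def)
        then show ?thesis
          using ij(1) by (force simp: image_iff)
      next
        case False
        then have "(i, j) \<in> Sigma I1 Y"
          using ij imp[OF ij(2-4)] iff(2)[OF ij(2,3)] by (simp add: I1_def Y_def)
        then show ?thesis
          using ij(1) by simp
      qed
    qed
    show "?R \<subseteq> ?L"
      using iff by (auto simp: J1_def X_def I1_def Y_def)
  qed
  have disj: "prod.swap ` Sigma J1 X \<inter> Sigma I1 Y = {}"
    by (auto simp: J1_def Y_def)
  have "product_count t = card (prod.swap ` Sigma J1 X) + card (Sigma I1 Y)"
    unfolding product_count_def tail_count_def set_eq
    using fin fX fY by (intro card_Un_disjoint disj) auto
  also have "card (prod.swap ` Sigma J1 X) = (\<Sum>j\<in>J1. card (X j))"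
    using fin fX by (simp add: card_image card_SigmaI)
  also have "card (Sigma I1 Y) = (\<Sum>i\<in>I1. card (Y i))"
    using fin fY by (simp add: card_SigmaI)
  finally have "real (product_count t) = (\<Sum>j\<in>J1. real (card (X j))) + (\<Sum>i\<in>I1. real (card (Y i)))"
    by simp
  also have "(\<Sum>i\<in>I1. real (card (Y i))) = small_part \<epsilon> t"
    unfolding small_part_def I1_def[symmetric]
  proof (rule sum.cong[OF refl])
    fix i assume i: "i \<in> I1"
    then have li: "t / l i \<le> t / \<epsilon>" "t / l i > 0"
      using t by (auto simp: I1_def intro!: divide_left_mono)
    then have "Y i = {j\<in>J. t / l i < m j} - {j\<in>J. t / \<epsilon> < m j}"
      by (auto simp: Y_def)
    moreover have "card ({j\<in>J. t / l i < m j} - {j\<in>J. t / \<epsilon> < m j}) =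
        tail_count J m (t / l i) - tail_count J m (t / \<epsilon>)"
      unfolding tail_count_def using li(1) by (intro card_Diff_subset S'.finite_level[OF te]) auto
    ultimately show "real (card (Y i)) = real (tail_count J m (t / l i)) - real (tail_count J m (t / \<epsilon>))"
      using S'.tail_count_antimono[OF li(2,1)] by simp
  qed
  also have "(\<Sum>j\<in>J1. real (card (X j))) = large_part \<epsilon> t + middle_part \<epsilon> t"
  proof -
    have "J1 = {j. j \<in> J \<and> \<epsilon> < m j} \<union> {j. j \<in> J \<and> t / \<epsilon> < m j \<and> m j \<le> \<epsilon>}"
      using t(2) by (auto simp: J1_def)
    moreover have "{j. j \<in> J \<and> \<epsilon> < m j} \<inter> {j. j \<in> J \<and> t / \<epsilon> < m j \<and> m j \<le> \<epsilon>} = {}"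
      by auto
    ultimately show ?thesis
      using fin(1) unfolding large_part_def middle_part_def X_def tail_count_def
      by (metis (no_types, lifting) finite_Un sum.union_disjoint)
  qed
  finally show ?thesis .
qed

lemma large_part_tendsto:
  assumes "\<epsilon> > 0"
  shows "((\<lambda>t. large_part \<epsilon> t / \<phi> (1 / t)) \<longlongrightarrow> real (tail_count J m \<epsilon>)) (at_right 0)"
proof -
  have "((\<lambda>t. \<Sum>j | j \<in> J \<and> \<epsilon> < m j. real (tail_count I l (t / m j)) / \<phi> (1 / t)) \<longlongrightarrow>
      (\<Sum>j | j \<in> J \<and> \<epsilon> < m j. 1)) (at_right 0)"
    by (intro tendsto_sum S.tail_count_ratio_tendsto) (use S'.pos in auto)
  then show ?thesis
    by (simp add: large_part_def tail_count_def sum_divide_distrib)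
qed

lemma small_part_tendsto:
  assumes "\<epsilon> > 0"
  shows "((\<lambda>t. small_part \<epsilon> t / \<psi> (1 / t)) \<longlongrightarrow> 0) (at_right 0)"
proof -
  have "((\<lambda>t. \<Sum>i | i \<in> I \<and> \<epsilon> < l i. real (tail_count J m (t / l i)) / \<psi> (1 / t) -
      real (tail_count J m (t / \<epsilon>)) / \<psi> (1 / t)) \<longlongrightarrow> (\<Sum>i | i \<in> I \<and> \<epsilon> < l i. 1 - 1)) (at_right 0)"
    by (intro tendsto_sum tendsto_diff S'.tail_count_ratio_tendsto) (use S.pos assms in auto)
  then show ?thesis
    by (simp add: small_part_def sum_divide_distrib diff_divide_distrib)
qed

lemma small_part_nonneg:
  assumes "t > 0" "\<epsilon> > 0"
  shows "small_part \<epsilon> t \<ge> 0"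
  unfolding small_part_def
proof (intro sum_nonneg)
  fix i assume "i \<in> {i. i \<in> I \<and> \<epsilon> < l i}"
  then have "tail_count J m (t / \<epsilon>) \<le> tail_count J m (t / l i)"
    using assms S.pos by (intro S'.tail_count_antimono) (auto intro!: divide_left_mono)
  then show "0 \<le> real (tail_count J m (t / l i)) - real (tail_count J m (t / \<epsilon>))"
    by simp
qed

text \<open>The second summand is the boundary term at \<open>1 / \<epsilon>\<close> which summation
  by parts leaves in the middle part. It cancels the count from the large part up to the factor
  \<open>1 - x\<close>, whose sign is favourable both for \<open>x \<ge> 1\<close> in the upper
  bound and for \<open>x \<le> 1\<close> in the lower one.\<close>

lemma leading_term_tendsto:
  assumes "\<epsilon> > 0"
  shows "((\<lambda>t. large_part \<epsilon> t / \<phi> (1 / t) + x * (\<phi> (\<epsilon> / t) / \<phi> (1 / t)) * (x * \<psi> (1 / \<epsilon>) - tail_count J m \<epsilon>))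
    \<longlongrightarrow> x\<^sup>2 * \<psi> (1 / \<epsilon>) + (1 - x) * real (tail_count J m \<epsilon>)) (at_right 0)"
proof -
  have "((\<lambda>t. large_part \<epsilon> t / \<phi> (1 / t) + x * (\<phi> (\<epsilon> / t) / \<phi> (1 / t)) * (x * \<psi> (1 / \<epsilon>) - tail_count J m \<epsilon>))
    \<longlongrightarrow> real (tail_count J m \<epsilon>) + x * 1 * (x * \<psi> (1 / \<epsilon>) - tail_count J m \<epsilon>)) (at_right 0)"
    by (intro tendsto_intros large_part_tendsto S.\<phi>_ratio_tendsto assms)
  then show ?thesis
    by (simp add: algebra_simps power2_eq_square)
qed

lemma eventually_small:
  fixes \<epsilon> :: real
  assumes "\<epsilon> > 0"
  shows "\<forall>\<^sub>F t in at_right 0. t > 0 \<and> t / \<epsilon> \<le> \<epsilon>"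
proof -
  have "\<forall>\<^sub>F t in at_right 0. t < \<epsilon> * \<epsilon>"
    using assms unfolding eventually_at_right_field by (intro exI[of _ "\<epsilon> * \<epsilon>"]) simp
  then show ?thesis
    using eventually_at_right_less[of "0::real"]
    by eventually_elim (use assms in \<open>simp add: field_simps\<close>)
qed

text \<open>The factor \<open>x\<close> is spent twice on the middle part: on the count of
  \<open>I\<close> inside each summand, then on the count of \<open>J\<close> in the summation by
  parts. Hence the square.\<close>

lemma product_count_upper:
  assumes \<epsilon>: "\<epsilon> > 0" and x: "x \<ge> 1" and \<delta>: "\<delta> > 0"
    and le: "\<And>s::real. 0 < s \<Longrightarrow> s \<le> \<epsilon> \<Longrightarrow> real (tail_count I l s) \<le> x * \<phi> (1 / s)"
      "\<And>s::real. 0 < s \<Longrightarrow> s \<le> \<epsilon> \<Longrightarrow> real (tail_count J m s) \<le> x * \<psi> (1 / s)"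
  shows "\<forall>\<^sub>F t in at_right 0. real (product_count t) \<le>
    x\<^sup>2 * (\<phi> (1 / t) * (\<psi> (1 / \<epsilon>) + \<delta>) + \<delta> * \<psi> (1 / t) + main_integral \<epsilon> t)"
proof -
  let ?c = "x * \<psi> (1 / \<epsilon>) - tail_count J m \<epsilon>"
  let ?X = "\<lambda>t. large_part \<epsilon> t / \<phi> (1 / t) + x * (\<phi> (\<epsilon> / t) / \<phi> (1 / t)) * ?c"
  have "(1 - x) * real (tail_count J m \<epsilon>) \<le> 0"
    using x by (intro mult_nonpos_nonneg) auto
  moreover have xd: "x\<^sup>2 * \<delta> > 0"
    using x \<delta> by simp
  ultimately have "x\<^sup>2 * \<psi> (1 / \<epsilon>) + (1 - x) * real (tail_count J m \<epsilon>) < x\<^sup>2 * (\<psi> (1 / \<epsilon>) + \<delta>)"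
    by (simp add: distrib_left)
  then have 1: "\<forall>\<^sub>F t in at_right 0. ?X t < x\<^sup>2 * (\<psi> (1 / \<epsilon>) + \<delta>)"
    by (rule order_tendstoD(2)[OF leading_term_tendsto[OF \<epsilon>]])
  have 2: "\<forall>\<^sub>F t in at_right 0. small_part \<epsilon> t / \<psi> (1 / t) < x\<^sup>2 * \<delta>"
    by (rule order_tendstoD(2)[OF small_part_tendsto[OF \<epsilon>] xd])
  show ?thesis
    using 1 2 eventually_small[OF \<epsilon>]
  proof eventually_elim
    case (elim t)
    then have t: "0 < t" "t / \<epsilon> \<le> \<epsilon>" by auto
    have pos: "\<phi> (1 / t) > 0" "\<psi> (1 / t) > 0"
      using t by (auto intro: S.\<phi>_pos S'.\<phi>_pos)
    have "middle_part \<epsilon> t \<le> (\<Sum>j | j \<in> J \<and> t / \<epsilon> < m j \<and> m j \<le> \<epsilon>. x * \<phi> (m j / t))"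
      unfolding middle_part_def
    proof (rule sum_mono)
      fix j assume j: "j \<in> {j. j \<in> J \<and> t / \<epsilon> < m j \<and> m j \<le> \<epsilon>}"
      then have "0 < t / m j" "t / m j \<le> \<epsilon>"
        using t \<epsilon> S'.pos[of j] by (auto simp: field_simps)
      from le(1)[OF this] show "real (tail_count I l (t / m j)) \<le> x * \<phi> (m j / t)"
        by simp
    qed
    also have "\<dots> \<le> x * (x * main_integral \<epsilon> t - \<phi> (\<epsilon> / t) * (tail_count J m \<epsilon> - x * \<psi> (1 / \<epsilon>)))"
      unfolding sum_distrib_left[symmetric] main_integral_def
      using x S.\<phi>_pos le(2)
      by (intro mult_left_mono S'.sum_vs_stieltjes_integral(1) t \<epsilon> S.C2 S.mono)
        (auto intro: less_imp_le)
    finally have mid: "middle_part \<epsilon> t \<le> x\<^sup>2 * main_integral \<epsilon> t + x * \<phi> (\<epsilon> / t) * ?c"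
      by (simp add: algebra_simps power2_eq_square)
    have "large_part \<epsilon> t + x * \<phi> (\<epsilon> / t) * ?c = ?X t * \<phi> (1 / t)"
      using pos by (simp add: field_simps)
    also have "\<dots> \<le> x\<^sup>2 * (\<psi> (1 / \<epsilon>) + \<delta>) * \<phi> (1 / t)"
      using elim(1) pos by (intro mult_right_mono) auto
    finally have lead: "large_part \<epsilon> t + x * \<phi> (\<epsilon> / t) * ?c \<le> x\<^sup>2 * (\<psi> (1 / \<epsilon>) + \<delta>) * \<phi> (1 / t)" .
    have small: "small_part \<epsilon> t \<le> x\<^sup>2 * \<delta> * \<psi> (1 / t)"
      using elim(2) pos by (simp add: field_simps)
    have "real (product_count t) \<le> x\<^sup>2 * (\<psi> (1 / \<epsilon>) + \<delta>) * \<phi> (1 / t) + x\<^sup>2 * main_integral \<epsilon> t + x\<^sup>2 * \<delta> * \<psi> (1 / t)"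
      using product_count_decomposition[OF t \<epsilon>] mid lead small by linarith
    then show ?case
      by (simp add: algebra_simps)
  qed
qed

lemma product_count_lower:
  assumes \<epsilon>: "\<epsilon> > 0" and x: "0 < x" "x \<le> 1" and \<delta>: "\<delta> > 0"
    and ge: "\<And>s::real. 0 < s \<Longrightarrow> s \<le> \<epsilon> \<Longrightarrow> x * \<phi> (1 / s) \<le> real (tail_count I l s)"
      "\<And>s::real. 0 < s \<Longrightarrow> s \<le> \<epsilon> \<Longrightarrow> x * \<psi> (1 / s) \<le> real (tail_count J m s)"
  shows "\<forall>\<^sub>F t in at_right 0.
    x\<^sup>2 * (\<phi> (1 / t) * (\<psi> (1 / \<epsilon>) - \<delta>) + main_integral \<epsilon> t) \<le> real (product_count t)"
proof -
  let ?c = "x * \<psi> (1 / \<epsilon>) - tail_count J m \<epsilon>"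
  let ?X = "\<lambda>t. large_part \<epsilon> t / \<phi> (1 / t) + x * (\<phi> (\<epsilon> / t) / \<phi> (1 / t)) * ?c"
  have "(1 - x) * real (tail_count J m \<epsilon>) \<ge> 0"
    using x by (intro mult_nonneg_nonneg) auto
  moreover have xd: "x\<^sup>2 * \<delta> > 0"
    using x \<delta> by simp
  ultimately have "x\<^sup>2 * (\<psi> (1 / \<epsilon>) - \<delta>) < x\<^sup>2 * \<psi> (1 / \<epsilon>) + (1 - x) * real (tail_count J m \<epsilon>)"
    by (simp add: right_diff_distrib)
  then have 1: "\<forall>\<^sub>F t in at_right 0. x\<^sup>2 * (\<psi> (1 / \<epsilon>) - \<delta>) < ?X t"
    by (rule order_tendstoD(1)[OF leading_term_tendsto[OF \<epsilon>]])
  show ?thesis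
    using 1 eventually_small[OF \<epsilon>]
  proof eventually_elim
    case (elim t)
    then have t: "0 < t" "t / \<epsilon> \<le> \<epsilon>" by auto
    have pos: "\<phi> (1 / t) > 0" "\<psi> (1 / t) > 0"
      using t by (auto intro: S.\<phi>_pos S'.\<phi>_pos)
    have "x * (x * main_integral \<epsilon> t - \<phi> (\<epsilon> / t) * (tail_count J m \<epsilon> - x * \<psi> (1 / \<epsilon>))) \<le>
        (\<Sum>j | j \<in> J \<and> t / \<epsilon> < m j \<and> m j \<le> \<epsilon>. x * \<phi> (m j / t))"
      unfolding sum_distrib_left[symmetric] main_integral_def
      using x S.\<phi>_pos ge(2)
      by (intro mult_left_mono S'.sum_vs_stieltjes_integral(2) t \<epsilon> S.C2 S.mono)
        (auto intro: less_imp_le)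
    also have "\<dots> \<le> middle_part \<epsilon> t"
      unfolding middle_part_def
    proof (rule sum_mono)
      fix j assume j: "j \<in> {j. j \<in> J \<and> t / \<epsilon> < m j \<and> m j \<le> \<epsilon>}"
      then have "0 < t / m j" "t / m j \<le> \<epsilon>"
        using t \<epsilon> S'.pos[of j] by (auto simp: field_simps)
      from ge(1)[OF this] show "x * \<phi> (m j / t) \<le> real (tail_count I l (t / m j))"
        by simp
    qed
    finally have mid: "x\<^sup>2 * main_integral \<epsilon> t + x * \<phi> (\<epsilon> / t) * ?c \<le> middle_part \<epsilon> t"
      by (simp add: algebra_simps power2_eq_square)
    have "x\<^sup>2 * (\<psi> (1 / \<epsilon>) - \<delta>) * \<phi> (1 / t) \<le> ?X t * \<phi> (1 / t)"
      using elim(1) pos by (intro mult_right_mono) auto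
    also have "\<dots> = large_part \<epsilon> t + x * \<phi> (\<epsilon> / t) * ?c"
      using pos by (simp add: field_simps)
    finally have "x\<^sup>2 * (\<psi> (1 / \<epsilon>) - \<delta>) * \<phi> (1 / t) + x\<^sup>2 * main_integral \<epsilon> t \<le> real (product_count t)"
      using product_count_decomposition[OF t \<epsilon>] small_part_nonneg[OF t(1) \<epsilon>] mid by linarith
    then show ?case
      by (simp add: algebra_simps)
  qed
qed

text \<open>
  For small \<open>\<epsilon>\<close> one may take \<open>\<epsilon>' = \<epsilon>\<close>. A smaller \<open>\<epsilon>'\<close> serves large \<open>\<epsilon>\<close>, where the counting
  functions may vanish on part of \<open>{0<..\<epsilon>}\<close>.
\<close>

definition admissible :: "real \<Rightarrow> real \<Rightarrow> bool"
  where "admissible \<epsilon> x \<longleftrightarrow> x \<ge> 1 \<and> (\<exists>\<epsilon>'>0. \<epsilon>' \<le> \<epsilon> \<and> \<epsilon> / \<epsilon>' \<le> x \<and>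
    (\<forall>s::real. 0 < s \<longrightarrow> s \<le> \<epsilon> \<longrightarrow> real (tail_count I l s) \<le> sqrt x * \<phi> (1 / s) \<and>
      real (tail_count J m s) \<le> sqrt x * \<psi> (1 / s)) \<and>
    (\<forall>s::real. 0 < s \<longrightarrow> s \<le> \<epsilon>' \<longrightarrow> \<phi> (1 / s) / sqrt x \<le> real (tail_count I l s) \<and>
      \<psi> (1 / s) / sqrt x \<le> real (tail_count J m s)))"

section \<open>Constants valid for all \<open>\<epsilon>\<close> and the two-sided estimates\<close>

lemma ratio_bounds:
  assumes "r > 1"
  shows "\<exists>\<epsilon>>0. \<forall>s::real. 0 < s \<longrightarrow> s \<le> \<epsilon> \<longrightarrow>
    real (tail_count I l s) \<le> r * \<phi> (1 / s) \<and> \<phi> (1 / s) / r \<le> real (tail_count I l s) \<and>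
    real (tail_count J m s) \<le> r * \<psi> (1 / s) \<and> \<psi> (1 / s) / r \<le> real (tail_count J m s)"
proof -
  have "\<forall>\<^sub>F s in at_right 0.
    real (tail_count I l s) \<le> r * \<phi> (1 / s) \<and> \<phi> (1 / s) / r \<le> real (tail_count I l s) \<and>
    real (tail_count J m s) \<le> r * \<psi> (1 / s) \<and> \<psi> (1 / s) / r \<le> real (tail_count J m s)"
    using S.eventually_tail_count_bounds[OF assms] S'.eventually_tail_count_bounds[OF assms]
    by eventually_elim simp
  then obtain b where "b > 0" "\<And>s::real. 0 < s \<Longrightarrow> s < b \<Longrightarrow>
    real (tail_count I l s) \<le> r * \<phi> (1 / s) \<and> \<phi> (1 / s) / r \<le> real (tail_count I l s) \<and>
    real (tail_count J m s) \<le> r * \<psi> (1 / s) \<and> \<psi> (1 / s) / r \<le> real (tail_count J m s)"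
    unfolding eventually_at_right_field by blast
  then show ?thesis
    by (intro exI[of _ "b / 2"]) simp
qed

lemma admissible_mono:
  assumes "admissible \<epsilon> x" "x \<le> y"
  shows "admissible \<epsilon> y"
proof -
  obtain \<epsilon>' where x: "x \<ge> 1" and \<epsilon>': "\<epsilon>' > 0" "\<epsilon>' \<le> \<epsilon>" "\<epsilon> / \<epsilon>' \<le> x"
    and U: "\<And>s::real. 0 < s \<Longrightarrow> s \<le> \<epsilon> \<Longrightarrow> real (tail_count I l s) \<le> sqrt x * \<phi> (1 / s) \<and>
      real (tail_count J m s) \<le> sqrt x * \<psi> (1 / s)"
    and L: "\<And>s::real. 0 < s \<Longrightarrow> s \<le> \<epsilon>' \<Longrightarrow> \<phi> (1 / s) / sqrt x \<le> real (tail_count I l s) \<and>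
      \<psi> (1 / s) / sqrt x \<le> real (tail_count J m s)"
    using assms(1) unfolding admissible_def by blast
  have sq: "1 \<le> sqrt x" "sqrt x \<le> sqrt y"
    using x assms(2) by auto
  have up: "a \<le> sqrt x * b \<Longrightarrow> a \<le> sqrt y * b" and down: "b / sqrt x \<le> a \<Longrightarrow> b / sqrt y \<le> a"
    if "b > 0" for a b
  proof -
    have "sqrt x * b \<le> sqrt y * b"
      using sq that by (intro mult_right_mono) auto
    then show "a \<le> sqrt x * b \<Longrightarrow> a \<le> sqrt y * b" by linarith
    have "b / sqrt y \<le> b / sqrt x"
      using sq that x assms(2) by (intro divide_left_mono) auto
    then show "b / sqrt x \<le> a \<Longrightarrow> b / sqrt y \<le> a" by linarith
  qed
  show ?thesis
    unfolding admissible_def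
  proof (intro conjI exI[of _ \<epsilon>'] allI impI)
    fix s :: real assume s: "0 < s"
    then have pos: "\<phi> (1 / s) > 0" "\<psi> (1 / s) > 0"
      by (auto intro: S.\<phi>_pos S'.\<phi>_pos)
    show "real (tail_count I l s) \<le> sqrt y * \<phi> (1 / s)" "real (tail_count J m s) \<le> sqrt y * \<psi> (1 / s)"
      if "s \<le> \<epsilon>"
      using U[OF s that] up pos by blast+
    show "\<phi> (1 / s) / sqrt y \<le> real (tail_count I l s)" "\<psi> (1 / s) / sqrt y \<le> real (tail_count J m s)"
      if "s \<le> \<epsilon>'"
      using L[OF s that] down pos by blast+
  qed (use x \<epsilon>' assms(2) in auto)
qed

lemma ex_admissible:
  assumes \<epsilon>: "\<epsilon> > 0"
  shows "\<exists>x. admissible \<epsilon> x"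
proof -
  obtain \<epsilon>1 where \<epsilon>1: "\<epsilon>1 > 0" and *: "\<And>s::real. 0 < s \<Longrightarrow> s \<le> \<epsilon>1 \<Longrightarrow>
    real (tail_count I l s) \<le> 2 * \<phi> (1 / s) \<and> \<phi> (1 / s) / 2 \<le> real (tail_count I l s) \<and>
    real (tail_count J m s) \<le> 2 * \<psi> (1 / s) \<and> \<psi> (1 / s) / 2 \<le> real (tail_count J m s)"
    using ratio_bounds[of 2] by auto
  define \<epsilon>' where "\<epsilon>' = min \<epsilon> \<epsilon>1"
  \<comment> \<open>One summand for each constraint: the ratio
    \<open>\<epsilon> / \<epsilon>'\<close>, the two counts between \<open>\<epsilon>'\<close> and
    \<open>\<epsilon>\<close>, and 2 for the range up to \<open>\<epsilon>'\<close>. The witness is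
    the square of \<open>y\<close>, because \<open>admissible\<close> bounds the counts with
    \<open>sqrt\<close>.\<close>
  define y where "y = 2 + \<epsilon> / \<epsilon>' + real (tail_count I l \<epsilon>') / \<phi> (1 / \<epsilon>) + real (tail_count J m \<epsilon>') / \<psi> (1 / \<epsilon>)"
  have \<epsilon>': "\<epsilon>' > 0" "\<epsilon>' \<le> \<epsilon>" "\<epsilon>' \<le> \<epsilon>1"
    using \<epsilon> \<epsilon>1 by (auto simp: \<epsilon>'_def)
  have nn: "\<epsilon> / \<epsilon>' \<ge> 0" "real (tail_count I l \<epsilon>') / \<phi> (1 / \<epsilon>) \<ge> 0" "real (tail_count J m \<epsilon>') / \<psi> (1 / \<epsilon>) \<ge> 0"
    using \<epsilon> \<epsilon>' S.\<phi>_pos[of "1 / \<epsilon>"] S'.\<phi>_pos[of "1 / \<epsilon>"] by auto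
  have y: "y \<ge> 2" "\<epsilon> / \<epsilon>' \<le> y" "2 + real (tail_count I l \<epsilon>') / \<phi> (1 / \<epsilon>) \<le> y"
    "2 + real (tail_count J m \<epsilon>') / \<psi> (1 / \<epsilon>) \<le> y"
    using nn by (auto simp: y_def)
  have y2: "y \<le> y\<^sup>2" "sqrt (y\<^sup>2) = y"
    using y(1) by (auto simp: power2_eq_square)
  have half: "a / y \<le> a / 2" if "a > 0" for a
    using y(1) that by (intro divide_left_mono) auto
  have "admissible \<epsilon> (y\<^sup>2)"
    unfolding admissible_def y2(2)
  proof (intro conjI exI[of _ \<epsilon>'] allI impI)
    fix s :: real assume s: "0 < s"
    then have pos: "\<phi> (1 / s) > 0" "\<psi> (1 / s) > 0"
      by (auto intro: S.\<phi>_pos S'.\<phi>_pos)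
    show "real (tail_count I l s) \<le> y * \<phi> (1 / s)" if "s \<le> \<epsilon>"
      by (rule S.ex_tail_count_bound[OF \<epsilon>'(1,2) _ y(3) s that]) (use * \<epsilon>'(3) in auto)
    show "real (tail_count J m s) \<le> y * \<psi> (1 / s)" if "s \<le> \<epsilon>"
      by (rule S'.ex_tail_count_bound[OF \<epsilon>'(1,2) _ y(4) s that]) (use * \<epsilon>'(3) in auto)
    show "\<phi> (1 / s) / y \<le> real (tail_count I l s)" "\<psi> (1 / s) / y \<le> real (tail_count J m s)" if "s \<le> \<epsilon>'"
      using *[OF s order_trans[OF that \<epsilon>'(3)]] half[OF pos(1)] half[OF pos(2)] by linarith+
  qed (use \<epsilon>' y y2 in auto)
  then show ?thesis by blast
qed

lemma eventually_admissible:
  assumes "\<delta> > 0"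
  shows "\<forall>\<^sub>F \<epsilon> in at_right 0. admissible \<epsilon> (1 + \<delta>)"
proof -
  have "sqrt (1 + \<delta>) > 1"
    using assms by simp
  from ratio_bounds[OF this] obtain \<epsilon>0 where "\<epsilon>0 > 0" and
    *: "\<And>s::real. 0 < s \<Longrightarrow> s \<le> \<epsilon>0 \<Longrightarrow>
      real (tail_count I l s) \<le> sqrt (1 + \<delta>) * \<phi> (1 / s) \<and> \<phi> (1 / s) / sqrt (1 + \<delta>) \<le> real (tail_count I l s) \<and>
      real (tail_count J m s) \<le> sqrt (1 + \<delta>) * \<psi> (1 / s) \<and> \<psi> (1 / s) / sqrt (1 + \<delta>) \<le> real (tail_count J m s)"
    by auto
  have "admissible \<epsilon> (1 + \<delta>)" if "0 < \<epsilon>" "\<epsilon> < \<epsilon>0" for \<epsilon>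
    unfolding admissible_def
    by (intro conjI exI[of _ \<epsilon>] allI impI) (use * that assms in auto)
  then show ?thesis
    unfolding eventually_at_right_field using \<open>\<epsilon>0 > 0\<close> by blast
qed

lemma main_integral_le:
  assumes "0 < t" "0 < \<epsilon>" "x \<ge> 1"
  shows "main_integral \<epsilon> t \<le> stieltjes_integral \<psi> (1 / x / \<epsilon>) (\<epsilon> * (x / t)) (\<lambda>\<sigma>. \<phi> (x / t / \<sigma>))"
  unfolding main_integral_def
proof (rule stieltjes_integral_mono[OF S'.C2 S'.mono])
  show "continuous_on {0<..} (\<lambda>\<sigma>. \<phi> (1 / t / \<sigma>))" "continuous_on {0<..} (\<lambda>\<sigma>. \<phi> (x / t / \<sigma>))"
    by (intro S.continuous_on_\<phi>_divide; use assms in simp)+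
  show "0 \<le> \<phi> (x / t / \<sigma>)" "\<phi> (1 / t / \<sigma>) \<le> \<phi> (x / t / \<sigma>)" if "\<sigma> > 0" for \<sigma>
    using assms that by (auto intro!: less_imp_le[OF S.\<phi>_pos] S.\<phi>_mono divide_right_mono)
qed (use assms in \<open>auto simp: field_simps\<close>)

text \<open>The condition \<open>\<epsilon> / \<epsilon>' \<le> x\<close> is what places
  \<open>[x / \<epsilon>, \<epsilon> / (x * t)]\<close> inside
  \<open>[1 / \<epsilon>', \<epsilon>' / t]\<close>.\<close>

lemma le_main_integral:
  assumes "0 < t" "0 < \<epsilon>'" "\<epsilon>' \<le> \<epsilon>" "\<epsilon> / \<epsilon>' \<le> x" "x \<ge> 1"
  shows "stieltjes_integral \<psi> (x / \<epsilon>) (\<epsilon> * (1 / x / t)) (\<lambda>\<sigma>. \<phi> (1 / x / t / \<sigma>)) \<le> main_integral \<epsilon>' t"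
  unfolding main_integral_def
proof (rule stieltjes_integral_mono[OF S'.C2 S'.mono])
  show "continuous_on {0<..} (\<lambda>\<sigma>. \<phi> (1 / t / \<sigma>))" "continuous_on {0<..} (\<lambda>\<sigma>. \<phi> (1 / x / t / \<sigma>))"
    by (intro S.continuous_on_\<phi>_divide; use assms in simp)+
  show "0 \<le> \<phi> (1 / t / \<sigma>)" if "\<sigma> > 0" for \<sigma>
    using assms that by (auto intro!: less_imp_le[OF S.\<phi>_pos])
  show "\<phi> (1 / x / t / \<sigma>) \<le> \<phi> (1 / t / \<sigma>)" if "\<sigma> > 0" for \<sigma>
  proof (rule S.\<phi>_mono)
    show "1 / x / t / \<sigma> \<le> 1 / t / \<sigma>"
      by (intro divide_right_mono) (use assms that in auto)
  qed (use assms that in simp)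
qed (use assms in \<open>auto simp: field_simps\<close>)

text \<open>With \<open>\<alpha>p = f\<close> and \<open>\<alpha>m = 1 / f\<close>, the two
  estimates solved for the sum of \<open>S\<close> and \<open>S'\<close> place it between
  \<open>product_count t / f \<epsilon> - Ip \<epsilon> t\<close> and
  \<open>f \<epsilon> * product_count t - Im \<epsilon> t\<close>. \<open>split_error\<close> then
  supplies the summands.\<close>

lemma product_count_estimates:
  "\<exists>(\<alpha>p :: real \<Rightarrow> real) (\<alpha>m :: real \<Rightarrow> real) (S :: real \<Rightarrow> real \<Rightarrow> real) (S' :: real \<Rightarrow> real \<Rightarrow> real).
    (\<forall>\<epsilon>>0. \<alpha>p \<epsilon> > 0 \<and> \<alpha>m \<epsilon> > 0) \<and>
    (\<alpha>p \<longlongrightarrow> 1) (at_right 0) \<and> (\<alpha>m \<longlongrightarrow> 1) (at_right 0) \<and>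
    (\<forall>\<epsilon>>0.
      (\<forall>t>0. let \<tau>p = \<alpha>p \<epsilon> / t; \<tau>m = \<alpha>m \<epsilon> / t in
        real (product_count t) \<le>
          \<alpha>p \<epsilon> * (S t \<epsilon> + S' t \<epsilon> +
            stieltjes_integral \<psi> (\<alpha>m \<epsilon> / \<epsilon>) (\<epsilon> * \<tau>p) (\<lambda>\<sigma>. \<phi> (\<tau>p / \<sigma>))) \<and>
        real (product_count t) \<ge>
          \<alpha>m \<epsilon> * (S t \<epsilon> + S' t \<epsilon> +
            stieltjes_integral \<psi> (\<alpha>p \<epsilon> / \<epsilon>) (\<epsilon> * \<tau>m) (\<lambda>\<sigma>. \<phi> (\<tau>m / \<sigma>)))) \<and>
      (\<lambda>t. S t \<epsilon>) \<sim>[at_right 0] (\<lambda>t. \<phi> (1 / t) * \<psi> (1 / \<epsilon>)) \<and>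
      (\<lambda>t. S' t \<epsilon>) \<in> o[at_right 0](\<lambda>t. \<psi> (1 / t)))"
proof -
  have "\<exists>f. (\<forall>\<epsilon>>0. admissible \<epsilon> (f \<epsilon>)) \<and> (f \<longlongrightarrow> 1) (at_right 0)"
    by (rule ex_near_one[OF admissible_mono _ ex_admissible eventually_admissible])
      (auto simp: admissible_def)
  then obtain f where f: "\<And>\<epsilon>. \<epsilon> > 0 \<Longrightarrow> admissible \<epsilon> (f \<epsilon>)" and f_lim: "(f \<longlongrightarrow> 1) (at_right 0)"
    by blast
  define Ip where "Ip \<epsilon> t = stieltjes_integral \<psi> (1 / f \<epsilon> / \<epsilon>) (\<epsilon> * (f \<epsilon> / t)) (\<lambda>\<sigma>. \<phi> (f \<epsilon> / t / \<sigma>))" for \<epsilon> t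
  define Im where "Im \<epsilon> t = stieltjes_integral \<psi> (f \<epsilon> / \<epsilon>) (\<epsilon> * (1 / f \<epsilon> / t)) (\<lambda>\<sigma>. \<phi> (1 / f \<epsilon> / t / \<sigma>))" for \<epsilon> t
  have "\<exists>S S'. (\<forall>t>0. product_count t / f \<epsilon> - Ip \<epsilon> t \<le> S t + S' t \<and> S t + S' t \<le> f \<epsilon> * product_count t - Im \<epsilon> t) \<and>
    S \<sim>[at_right 0] (\<lambda>t. \<phi> (1 / t) * \<psi> (1 / \<epsilon>)) \<and> S' \<in> o[at_right 0](\<lambda>t. \<psi> (1 / t))"
    if \<epsilon>: "\<epsilon> > 0" for \<epsilon>
  proof (rule split_error)
    define x where "x = f \<epsilon>"
    obtain \<epsilon>' where x: "x \<ge> 1" and \<epsilon>': "\<epsilon>' > 0" "\<epsilon>' \<le> \<epsilon>" "\<epsilon> / \<epsilon>' \<le> x"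
      and U: "\<And>s::real. 0 < s \<Longrightarrow> s \<le> \<epsilon> \<Longrightarrow> real (tail_count I l s) \<le> sqrt x * \<phi> (1 / s) \<and>
        real (tail_count J m s) \<le> sqrt x * \<psi> (1 / s)"
      and L: "\<And>s::real. 0 < s \<Longrightarrow> s \<le> \<epsilon>' \<Longrightarrow> \<phi> (1 / s) / sqrt x \<le> real (tail_count I l s) \<and>
        \<psi> (1 / s) / sqrt x \<le> real (tail_count J m s)"
      using f[OF \<epsilon>] unfolding admissible_def x_def[symmetric] by blast
    have gt0: "\<forall>\<^sub>F t in at_right (0::real). t > 0"
      by (simp add: eventually_at_right_less)
    have Ip: "main_integral \<epsilon> t \<le> Ip \<epsilon> t" if "t > 0" for t
      unfolding Ip_def x_def[symmetric] by (rule main_integral_le[OF that \<epsilon> x])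
    have Im: "Im \<epsilon> t \<le> main_integral \<epsilon>' t" if "t > 0" for t
      unfolding Im_def x_def[symmetric] by (rule le_main_integral[OF that \<epsilon>' x])
    show "\<psi> (1 / \<epsilon>) > 0" "\<And>t. t > 0 \<Longrightarrow> \<phi> (1 / t) > 0" "\<And>t. t > 0 \<Longrightarrow> \<psi> (1 / t) > 0"
      using \<epsilon> by (auto intro: S.\<phi>_pos S'.\<phi>_pos)
    \<comment> \<open>The prescribed interval is nonempty for every \<open>t\<close>, because
      \<open>Im \<epsilon> t \<le> main_integral \<epsilon> t \<le> Ip \<epsilon> t\<close> and
      \<open>f \<epsilon> \<ge> 1\<close>.\<close>
    show "product_count t / f \<epsilon> - Ip \<epsilon> t \<le> f \<epsilon> * product_count t - Im \<epsilon> t" if t: "t > 0" for t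
    proof -
      have "Im \<epsilon> t \<le> main_integral \<epsilon> t"
        unfolding Im_def x_def[symmetric] by (rule le_main_integral[OF t \<epsilon> order_refl _ x]) (use \<epsilon> x in simp)
      moreover have "product_count t / x \<le> product_count t / 1"
        using x by (intro divide_left_mono) auto
      moreover have "1 * real (product_count t) \<le> x * product_count t"
        using x by (intro mult_right_mono) auto
      ultimately show ?thesis
        using Ip[OF t] unfolding x_def by simp
    qed
    fix \<delta> :: real assume \<delta>: "\<delta> > 0"
    \<comment> \<open>Both counts are bounded with \<open>sqrt x\<close>, so the product loses
      exactly the factor \<open>x = f \<epsilon>\<close>.\<close>
    have "\<forall>\<^sub>F t in at_right 0. real (product_count t) \<le>
        (sqrt x)\<^sup>2 * (\<phi> (1 / t) * (\<psi> (1 / \<epsilon>) + \<delta>) + \<delta> * \<psi> (1 / t) + main_integral \<epsilon> t)"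
      by (rule product_count_upper[OF \<epsilon> _ \<delta>]) (use U x in auto)
    then show "\<forall>\<^sub>F t in at_right 0. product_count t / f \<epsilon> - Ip \<epsilon> t \<le>
        \<phi> (1 / t) * (\<psi> (1 / \<epsilon>) + \<delta>) + \<delta> * \<psi> (1 / t)"
      using gt0
    proof eventually_elim
      case (elim t)
      then have "product_count t / x \<le> \<phi> (1 / t) * (\<psi> (1 / \<epsilon>) + \<delta>) + \<delta> * \<psi> (1 / t) + main_integral \<epsilon> t"
        using x by (simp add: field_simps)
      then show ?case
        using Ip[OF elim(2)] unfolding x_def by linarith
    qed
    \<comment> \<open>The lower bounds are available up to \<open>\<epsilon>'\<close>, so the count
      is split there instead; monotonicity of \<open>\<psi>\<close> and the bound \<open>Im\<close>
      return from \<open>\<epsilon>'\<close> to \<open>\<epsilon>\<close>.\<close>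
    have "\<forall>\<^sub>F t in at_right 0. (1 / sqrt x)\<^sup>2 * (\<phi> (1 / t) * (\<psi> (1 / \<epsilon>') - \<delta>) + main_integral \<epsilon>' t) \<le>
        real (product_count t)"
      by (rule product_count_lower[OF \<epsilon>'(1) _ _ \<delta>]) (use L x in auto)
    then show "\<forall>\<^sub>F t in at_right 0. \<phi> (1 / t) * (\<psi> (1 / \<epsilon>) - \<delta>) \<le> f \<epsilon> * product_count t - Im \<epsilon> t"
      using gt0
    proof eventually_elim
      case (elim t)
      then have "\<phi> (1 / t) * (\<psi> (1 / \<epsilon>') - \<delta>) + main_integral \<epsilon>' t \<le> x * product_count t"
        using x by (simp add: power_divide field_simps)
      moreover have "\<psi> (1 / \<epsilon>) \<le> \<psi> (1 / \<epsilon>')"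
        using \<epsilon> \<epsilon>' by (intro S'.\<phi>_mono) (auto simp: field_simps)
      then have "\<phi> (1 / t) * (\<psi> (1 / \<epsilon>) - \<delta>) \<le> \<phi> (1 / t) * (\<psi> (1 / \<epsilon>') - \<delta>)"
        using elim(2) by (intro mult_left_mono less_imp_le[OF S.\<phi>_pos]) auto
      ultimately show ?case
        using Im[OF elim(2)] unfolding x_def by linarith
    qed
  qed
  then obtain S S' where S: "\<And>\<epsilon> t. \<epsilon> > 0 \<Longrightarrow> t > 0 \<Longrightarrow> product_count t / f \<epsilon> - Ip \<epsilon> t \<le> S \<epsilon> t + S' \<epsilon> t"
    "\<And>\<epsilon> t. \<epsilon> > 0 \<Longrightarrow> t > 0 \<Longrightarrow> S \<epsilon> t + S' \<epsilon> t \<le> f \<epsilon> * product_count t - Im \<epsilon> t"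
    "\<And>\<epsilon>. \<epsilon> > 0 \<Longrightarrow> S \<epsilon> \<sim>[at_right 0] (\<lambda>t. \<phi> (1 / t) * \<psi> (1 / \<epsilon>))"
    "\<And>\<epsilon>. \<epsilon> > 0 \<Longrightarrow> S' \<epsilon> \<in> o[at_right 0](\<lambda>t. \<psi> (1 / t))"
    by metis
  have f_pos: "f \<epsilon> > 0" if "\<epsilon> > 0" for \<epsilon>
    using f[OF that] by (simp add: admissible_def)
  show ?thesis
  proof (rule exI[of _ f], rule exI[of _ "\<lambda>\<epsilon>. 1 / f \<epsilon>"], rule exI[of _ "\<lambda>t \<epsilon>. S \<epsilon> t"],
      rule exI[of _ "\<lambda>t \<epsilon>. S' \<epsilon> t"], intro conjI allI impI)
    show "((\<lambda>\<epsilon>. 1 / f \<epsilon>) \<longlongrightarrow> 1) (at_right 0)"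
      using f_lim by (auto intro!: tendsto_eq_intros)
    fix \<epsilon> :: real assume \<epsilon>: "\<epsilon> > 0"
    fix t :: real assume t: "t > 0"
    have "real (product_count t) \<le> f \<epsilon> * (S \<epsilon> t + S' \<epsilon> t + Ip \<epsilon> t)"
      using S(1)[OF \<epsilon> t] f_pos[OF \<epsilon>] by (simp add: field_simps)
    moreover have "1 / f \<epsilon> * (S \<epsilon> t + S' \<epsilon> t + Im \<epsilon> t) \<le> real (product_count t)"
      using S(2)[OF \<epsilon> t] f_pos[OF \<epsilon>] by (simp add: field_simps)
    ultimately show "let \<tau>p = f \<epsilon> / t; \<tau>m = 1 / f \<epsilon> / t in
        real (product_count t) \<le>
          f \<epsilon> * (S \<epsilon> t + S' \<epsilon> t +
            stieltjes_integral \<psi> (1 / f \<epsilon> / \<epsilon>) (\<epsilon> * \<tau>p) (\<lambda>\<sigma>. \<phi> (\<tau>p / \<sigma>))) \<and>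
        real (product_count t) \<ge>
          1 / f \<epsilon> * (S \<epsilon> t + S' \<epsilon> t +
            stieltjes_integral \<psi> (f \<epsilon> / \<epsilon>) (\<epsilon> * \<tau>m) (\<lambda>\<sigma>. \<phi> (\<tau>m / \<sigma>)))"
      by (simp only: Let_def Ip_def Im_def simp_thms)
  qed (use S(3,4) f_lim f_pos in simp_all)
qed

end

section \<open>Transfer from eigenvalue families to the operators\<close>

theorem theorem3p1:
  fixes smul1 :: "'k :: real_or_complex \<Rightarrow> 'a :: banach \<Rightarrow> 'a" and ip1 :: "'a \<Rightarrow> 'a \<Rightarrow> 'k"
    and smul2 :: "'k \<Rightarrow> 'b :: banach \<Rightarrow> 'b" and ip2 :: "'b \<Rightarrow> 'b \<Rightarrow> 'k"
    and smul3 :: "'k \<Rightarrow> 'c :: banach \<Rightarrow> 'c" and ip3 :: "'c \<Rightarrow> 'c \<Rightarrow> 'k"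
    and tens :: "'a \<Rightarrow> 'b \<Rightarrow> 'c"
    and T :: "'a \<Rightarrow> 'a" and T' :: "'b \<Rightarrow> 'b" and U :: "'c \<Rightarrow> 'c"
    and \<phi> \<psi> :: "real \<Rightarrow> real"
  assumes tensor: "hilbert_tensor_product smul1 ip1 smul2 ip2 smul3 ip3 tens"
    and T: "compact_operator smul1 T" "self_adjoint ip1 T" "nonneg_operator ip1 T"
    and T': "compact_operator smul2 T'" "self_adjoint ip2 T'" "nonneg_operator ip2 T'"
    and U: "tensor_operator smul3 tens T T' U"
    and N_T: "(\<lambda>t. real (counting_function smul1 T t)) \<sim>[at_right 0] (\<lambda>t. \<phi> (1 / t))"
    and N_T': "(\<lambda>t. real (counting_function smul2 T' t)) \<sim>[at_right 0] (\<lambda>t. \<psi> (1 / t))"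
    and \<phi>: "mono_on {0<..} \<phi>" "\<not> bounded (\<phi> ` {0<..})" "C2_on_pos \<phi>" "slowly_varying \<phi>"
    and \<psi>: "mono_on {0<..} \<psi>" "\<not> bounded (\<psi> ` {0<..})" "C2_on_pos \<psi>" "slowly_varying \<psi>"
  shows "\<exists>(\<alpha>p :: real \<Rightarrow> real) (\<alpha>m :: real \<Rightarrow> real) (S :: real \<Rightarrow> real \<Rightarrow> real) (S' :: real \<Rightarrow> real \<Rightarrow> real).
    (\<forall>\<epsilon>>0. \<alpha>p \<epsilon> > 0 \<and> \<alpha>m \<epsilon> > 0) \<and>
    (\<alpha>p \<longlongrightarrow> 1) (at_right 0) \<and> (\<alpha>m \<longlongrightarrow> 1) (at_right 0) \<and>
    (\<forall>\<epsilon>>0.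
      (\<forall>t>0. let \<tau>p = \<alpha>p \<epsilon> / t; \<tau>m = \<alpha>m \<epsilon> / t in
        real (counting_function smul3 U t) \<le>
          \<alpha>p \<epsilon> * (S t \<epsilon> + S' t \<epsilon> +
            stieltjes_integral \<psi> (\<alpha>m \<epsilon> / \<epsilon>) (\<epsilon> * \<tau>p) (\<lambda>\<sigma>. \<phi> (\<tau>p / \<sigma>))) \<and>
        real (counting_function smul3 U t) \<ge>
          \<alpha>m \<epsilon> * (S t \<epsilon> + S' t \<epsilon> +
            stieltjes_integral \<psi> (\<alpha>p \<epsilon> / \<epsilon>) (\<epsilon> * \<tau>m) (\<lambda>\<sigma>. \<phi> (\<tau>m / \<sigma>)))) \<and>
      (\<lambda>t. S t \<epsilon>) \<sim>[at_right 0] (\<lambda>t. \<phi> (1 / t) * \<psi> (1 / \<epsilon>)) \<and>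
      (\<lambda>t. S' t \<epsilon>) \<in> o[at_right 0](\<lambda>t. \<psi> (1 / t)))"
proof -
  interpret hilbert_tensor_product smul1 ip1 smul2 ip2 smul3 ip3 tens
    by (fact tensor)
  obtain E where E: "eigen_system smul1 ip1 T E (\<lambda>v. v) (\<lambda>v. norm (T v))"
    using left.ex_eigen_system[OF T] by blast
  obtain F where F: "eigen_system smul2 ip2 T' F (\<lambda>v. v) (\<lambda>v. norm (T' v))"
    using right.ex_eigen_system[OF T'] by blast
  note EF = eigen_system_tensor[OF E F U]
  have count1: "counting_function smul1 T t = tail_count E (\<lambda>v. norm (T v)) t" if "t > 0" for t
    using eigen_system.counting_function_eq[OF E that] by (simp add: tail_count_def)
  have count2: "counting_function smul2 T' t = tail_count F (\<lambda>v. norm (T' v)) t" if "t > 0" for t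
    using eigen_system.counting_function_eq[OF F that] by (simp add: tail_count_def)
  have gt0: "\<forall>\<^sub>F t in at_right (0::real). t > 0"
    by (simp add: eventually_at_right_less)
  interpret pair: slowly_varying_spectrum_pair E "\<lambda>v. norm (T v)" \<phi> F "\<lambda>v. norm (T' v)" \<psi>
  proof (intro slowly_varying_spectrum_pair.intro slowly_varying_spectrum.intro)
    \<comment> \<open>The two counts are known to agree for positive arguments, which suffices for
      asymptotics at \<open>0+\<close>.\<close>
    have "\<forall>\<^sub>F t in at_right 0. real (counting_function smul1 T t) = real (tail_count E (\<lambda>v. norm (T v)) t)"
      using gt0 by eventually_elim (simp add: count1)
    then show "(\<lambda>t. real (tail_count E (\<lambda>v. norm (T v)) t)) \<sim>[at_right 0] (\<lambda>t. \<phi> (1 / t))"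
      using N_T by (subst (asm) asymp_equiv_cong) auto
    have "\<forall>\<^sub>F t in at_right 0. real (counting_function smul2 T' t) = real (tail_count F (\<lambda>v. norm (T' v)) t)"
      using gt0 by eventually_elim (simp add: count2)
    then show "(\<lambda>t. real (tail_count F (\<lambda>v. norm (T' v)) t)) \<sim>[at_right 0] (\<lambda>t. \<psi> (1 / t))"
      using N_T' by (subst (asm) asymp_equiv_cong) auto
  qed (use \<phi> \<psi> eigen_system.l_pos[OF E] eigen_system.l_pos[OF F]
      eigen_system.finite_level[OF E] eigen_system.finite_level[OF F] in auto)
  have "counting_function smul3 U t = pair.product_count t" if "t > 0" for t
    using eigen_system.counting_function_eq[OF EF that]
    by (simp add: pair.product_count_def tail_count_def)
  \<comment> \<open>\<open>imp_cong\<close> makes \<open>t > 0\<close> available when the count is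
    rewritten under the quantifier.\<close>
  then show ?thesis
    using pair.product_count_estimates by (simp cong: imp_cong)
qed

end
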